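(* Let $E$ be a real uniformly convex and smooth Banach space, let $C$ be a nonempty bounded closed convex subset of $E$, and let $T:C\to C$ be an asymptotically nonexpansive mapping. Let $\{t_n\}_{n\ge 1}$ be a sequence in $(0,1)$ with $t_n\to 0$, let $x\in C$, and let $\{x_n\}_{n\ge 1}$ be the sequence generated by $x_1=x$, $C_0=D_0=C$ and, for $n=1,2,\ldots$, $$C_n=\overline{co}\{z\in C_{n-1}:\|z-T^nz\|\le t_n\|x_n-T^nx_n\|\},$$ $$D_n=\{z\in D_{n-1}:\langle x_n-z,J(x-x_n)\rangle\ge 0\},$$ $$x_{n+1}=P_{C_n\cap D_n}x.$$ Then $\{x_n\}$ converges strongly (in norm) to the element $P_{F(T)}x$ of $F(T)$, where $F(T)$ is the set of fixed points of $T$ and $P_{F(T)}$ is the metric projection from $E$ onto $F(T)$.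
   Context: A mapping $T:C\to C$ is asymptotically nonexpansive if there exists a sequence $\{k_n\}_{n\ge1}\subset[1,\infty)$ with $k_n\to1$ such that $\|T^nx-T^ny\|\le k_n\|x-y\|$ for all $x,y\in C$ and each $n\ge1$. $F(T)=\{z\in C: Tz=z\}$; under the stated hypotheses on $E$, $C$, $T$ it is known (Goebel--Kirk) that $F(T)$ is nonempty, closed and convex. $\overline{co}D$ denotes the closed convex hull of a set $D$. $\langle y,y^*\rangle$ denotes the value of $y^*\in E^*$ at $y\in E$. $J$ is the normalized duality mapping, $J(y)=\{y^*\in E^*:\langle y,y^*\rangle=\|y\|^2=\|y^*\|^2\}$, which is single-valued because $E$ is smooth. $E$ is smooth if $\lim_{t\to0}(\|y+tz\|-\|y\|)/t$ exists for all $y,z$ with $\|y\|=\|z\|=1$. $E$ is uniformly convex if $\|y_n-z_n\|\to0$ whenever $\|y_n\|=\|z_n\|=1$ and $\|y_n+z_n\|\to2$. For a nonempty closed convex set $K\subset E$ and $y\in E$, $P_Ky$ (the metric projection of $y$ onto $K$) is the unique point of $K$ with $\|P_Ky-y\|=\min_{w\in K}\|w-y\|$. *)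

theory Defs
  imports "HOL-Analysis.Analysis"
begin

text \<open>Geometry of the norm. The argument \<open>TYPE('a)\<close> stands for the whole space.\<close>

definition smooth_space :: "'a::real_normed_vector itself \<Rightarrow> bool" where
  "smooth_space _ \<longleftrightarrow>
     (\<forall>y z :: 'a. norm y = 1 \<and> norm z = 1 \<longrightarrow>
        (\<exists>l. ((\<lambda>t::real. (norm (y + t *\<^sub>R z) - norm y) / t) \<longlongrightarrow> l) (at 0)))"

definition uniformly_convex_space :: "'a::real_normed_vector itself \<Rightarrow> bool" where
  "uniformly_convex_space _ \<longleftrightarrow>
     (\<forall>y z :: nat \<Rightarrow> 'a.
        (\<forall>n. norm (y n) = 1 \<and> norm (z n) = 1) \<and> (\<lambda>n. norm (y n + z n)) \<longlonglongrightarrow> 2 \<longrightarrow>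
        (\<lambda>n. norm (y n - z n)) \<longlonglongrightarrow> 0)"

text \<open>The dual space of \<open>'a\<close> is the type \<open>'a \<Rightarrow>\<^sub>L real\<close> of bounded linear functionals with the
  operator norm.\<close>

definition duality_set :: "'a::real_normed_vector \<Rightarrow> ('a \<Rightarrow>\<^sub>L real) set" where
  "duality_set y = {f. blinfun_apply f y = (norm y)\<^sup>2 \<and> (norm y)\<^sup>2 = (norm f)\<^sup>2}"

text \<open>Only meaningful where \<^term>\<open>duality_set y\<close> is a singleton, as it is in a smooth space.\<close>

definition duality_map :: "'a::real_normed_vector \<Rightarrow> ('a \<Rightarrow>\<^sub>L real)" where
  "duality_map y = (THE f. f \<in> duality_set y)"

definition is_metric_projection :: "'a::real_normed_vector set \<Rightarrow> 'a \<Rightarrow> 'a \<Rightarrow> bool" where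
  "is_metric_projection K y p \<longleftrightarrow> p \<in> K \<and> (\<forall>w\<in>K. norm (p - y) \<le> norm (w - y))"

text \<open>Only meaningful where the minimiser exists and is unique, as it does for nonempty closed
  convex \<open>K\<close> in a uniformly convex Banach space. The library's \<open>closest_point\<close> requires
  an inner product and the Heine-Borel property, so it does not apply here.\<close>

definition metric_projection :: "'a::real_normed_vector set \<Rightarrow> 'a \<Rightarrow> 'a" where
  "metric_projection K y = (THE p. is_metric_projection K y p)"

definition asymptotically_nonexpansive_on ::
    "'a::real_normed_vector set \<Rightarrow> ('a \<Rightarrow> 'a) \<Rightarrow> bool" where
  "asymptotically_nonexpansive_on C T \<longleftrightarrow>
     T \<in> C \<rightarrow> C \<and>
     (\<exists>k :: nat \<Rightarrow> real. (\<forall>n\<ge>1. 1 \<le> k n) \<and> k \<longlonglongrightarrow> 1 \<and>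
        (\<forall>n\<ge>1. \<forall>x\<in>C. \<forall>y\<in>C. norm ((T ^^ n) x - (T ^^ n) y) \<le> k n * norm (x - y)))"

definition fixed_points_on :: "'a set \<Rightarrow> ('a \<Rightarrow> 'a) \<Rightarrow> 'a set" where
  "fixed_points_on C T = {z \<in> C. T z = z}"

end

theory Submission
  imports Defs
begin

text \<open>
  The sets \<open>D\<^sub>n\<close> are redundant: by the variational inequality for metric projections,
  \<open>C\<^sub>n \<subseteq> D\<^sub>n\<close>, so \<open>x\<^sub>n\<^sub>+\<^sub>1\<close> is the projection of \<open>x\<close> onto \<open>C\<^sub>n\<close>. As the \<open>C\<^sub>n\<close> decrease and
  contain the nonempty set \<open>F(T)\<close>, uniform convexity makes \<open>x\<^sub>n\<close> converge to the point \<open>q\<close> of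
  \<open>\<Inter>C\<^sub>n\<close> nearest to \<open>x\<close>, and it only remains to see that \<open>q\<close> is a fixed point. Since \<open>x\<^sub>n\<^sub>+\<^sub>1\<close> lies in the
  closed convex hull of almost fixed points of \<open>T\<^sup>n\<close>, Bruck's convex approximation property
  gives \<open>\<parallel>x\<^sub>n\<^sub>+\<^sub>1 - T\<^sup>n x\<^sub>n\<^sub>+\<^sub>1\<parallel> \<rightarrow> 0\<close>, hence \<open>T\<^sup>n q \<rightarrow> q\<close> and \<open>T q = q\<close>.

  Bruck's property for midpoints is immediate from uniform convexity. It passes to the whole convex hull
  because uniformly many iterated midpoints of a bounded set approximate every point of its convex hull.
\<close>

section \<open>Quantitative forms of uniform convexity\<close>

text \<open>If no \<open>\<delta>\<close> worked, counterexamples for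
  \<open>1 / real (Suc n)\<close> would form two sequences of unit vectors contradicting the
  sequential definition.\<close>

lemma uniformly_convex_unit_modulus:
  assumes "uniformly_convex_space TYPE('a::real_normed_vector)" and "\<epsilon> > 0"
  obtains \<delta> where "\<delta> > 0"
    "\<And>y z :: 'a. norm y = 1 \<Longrightarrow> norm z = 1 \<Longrightarrow> norm (y + z) > 2 - \<delta> \<Longrightarrow> norm (y - z) < \<epsilon>"
proof (rule ccontr)
  assume "\<not> thesis"
  with that have "\<exists>y z :: 'a. norm y = 1 \<and> norm z = 1 \<and> norm (y + z) > 2 - \<delta> \<and> norm (y - z) \<ge> \<epsilon>"
    if "\<delta> > 0" for \<delta>
    using \<open>\<delta> > 0\<close> by (metis not_less)
  then have "\<forall>n::nat. \<exists>y z :: 'a. norm y = 1 \<and> norm z = 1 \<and> norm (y + z) > 2 - 1 / real (Suc n)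
      \<and> norm (y - z) \<ge> \<epsilon>"
    by simp
  then obtain y z :: "nat \<Rightarrow> 'a" where yz: "\<And>n. norm (y n) = 1" "\<And>n. norm (z n) = 1"
      "\<And>n. norm (y n + z n) > 2 - 1 / real (Suc n)" "\<And>n. norm (y n - z n) \<ge> \<epsilon>"
    by metis
  have "(\<lambda>n. norm (y n + z n)) \<longlonglongrightarrow> 2"
  proof (rule tendsto_sandwich)
    show "\<forall>\<^sub>F n in sequentially. 2 - 1 / real (Suc n) \<le> norm (y n + z n)"
      using yz(3) by (simp add: less_imp_le)
    show "\<forall>\<^sub>F n in sequentially. norm (y n + z n) \<le> 2"
      using norm_triangle_ineq[of "y _" "z _"] by (simp add: yz)
    show "(\<lambda>n. 2 - 1 / real (Suc n)) \<longlonglongrightarrow> 2"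
      using tendsto_diff[OF tendsto_const LIMSEQ_inverse_real_of_nat, of "2::real"]
      by (simp add: field_simps)
  qed simp
  with assms(1) yz have "(\<lambda>n. norm (y n - z n)) \<longlonglongrightarrow> 0"
    unfolding uniformly_convex_space_def by blast
  then have "\<forall>\<^sub>F n in sequentially. norm (y n - z n) < \<epsilon>"
    using \<open>\<epsilon> > 0\<close> by (rule order_tendstoD)
  with yz(4) show False
    by (auto simp: eventually_sequentially not_less[symmetric])
qed

text \<open>One \<open>\<delta>\<close> serves all radii up to \<open>R\<close>, and the norm bounds
  have slack, so approximate minimisers are covered. Small radii follow from the triangle
  inequality; otherwise both vectors are close to \<open>r\<close> times their directions, where the
  unit modulus applies.\<close>

lemma uniformly_convex_modulus:
  assumes "uniformly_convex_space TYPE('a::real_normed_vector)" and "\<epsilon> > 0"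
  shows "\<exists>\<delta>>0. \<forall>r (a::'a) b. r \<le> R \<and> norm a \<le> r + \<delta> \<and> norm b \<le> r + \<delta> \<and>
      2 * (r - \<delta>) \<le> norm (a + b) \<longrightarrow> norm (a - b) \<le> \<epsilon>"
proof -
  define R' where "R' = max R 1"
  have "\<epsilon> / (4 * R') > 0" using assms(2) by (simp add: R'_def)
  from uniformly_convex_unit_modulus[OF assms(1) this] obtain \<eta> where \<eta>: "\<eta> > 0"
    "\<And>y z :: 'a. norm y = 1 \<Longrightarrow> norm z = 1 \<Longrightarrow> norm (y + z) > 2 - \<eta> \<Longrightarrow> norm (y - z) < \<epsilon> / (4 * R')"
    by blast
  \<comment> \<open>\<open>\<epsilon> / 16\<close> absorbs the errors \<open>3 * \<delta>\<close> in
    the final triangle inequality; \<open>\<epsilon> * \<eta> / 64\<close> gives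
    \<open>8 * \<delta> < r * \<eta>\<close> once \<open>r > \<epsilon> / 4\<close>.\<close>
  define \<delta> where "\<delta> = min (\<epsilon> / 16) (\<epsilon> * \<eta> / 64)"
  have \<delta>: "\<delta> > 0" "\<delta> \<le> \<epsilon> / 16" "\<delta> \<le> \<epsilon> * \<eta> / 64"
    using assms(2) \<eta>(1) by (auto simp: \<delta>_def)
  have "norm (a - b) \<le> \<epsilon>"
    if h: "r \<le> R" "norm a \<le> r + \<delta>" "norm b \<le> r + \<delta>" "norm (a + b) \<ge> 2 * (r - \<delta>)"
    for r and a b :: 'a
  proof (cases "r \<le> \<epsilon> / 4")
    case True
    then show ?thesis using norm_triangle_ineq4[of a b] h \<delta> by linarith
  next
    case False
    have r: "r > 0" "r \<le> R'" using False assms(2) h by (auto simp: R'_def)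
    \<comment> \<open>The lower bounds come from \<open>norm a \<ge> norm (a + b) - norm b\<close>
      and its mirror image.\<close>
    have na: "\<bar>norm a - r\<bar> \<le> 3 * \<delta>" "\<bar>norm b - r\<bar> \<le> 3 * \<delta>"
      using norm_triangle_ineq[of a b] h(2-4) \<delta>(1) unfolding abs_le_iff by auto
    then have "a \<noteq> 0" "b \<noteq> 0" using False \<delta> by auto
    have sg: "norm (v - r *\<^sub>R sgn v) \<le> 3 * \<delta>" if "v \<noteq> 0" "\<bar>norm v - r\<bar> \<le> 3 * \<delta>" for v :: 'a
    proof -
      have "v - r *\<^sub>R sgn v = (norm v - r) *\<^sub>R sgn v"
        using that by (simp add: sgn_div_norm left_diff_distrib scaleR_diff_left)
      then show ?thesis using that by (simp add: norm_sgn)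
    qed
    have da: "norm (a - r *\<^sub>R sgn a) \<le> 3 * \<delta>" and db: "norm (b - r *\<^sub>R sgn b) \<le> 3 * \<delta>"
      using sg na \<open>a \<noteq> 0\<close> \<open>b \<noteq> 0\<close> by auto
    have eq1: "a + b = r *\<^sub>R (sgn a + sgn b) + ((a - r *\<^sub>R sgn a) + (b - r *\<^sub>R sgn b))"
      by (simp add: scaleR_add_right)
    have "2 * (r - \<delta>) \<le> r * norm (sgn a + sgn b) + 6 * \<delta>"
      using h(4) da db norm_triangle_ineq[of "r *\<^sub>R (sgn a + sgn b)" "(a - r *\<^sub>R sgn a) + (b - r *\<^sub>R sgn b)"]
        norm_triangle_ineq[of "a - r *\<^sub>R sgn a" "b - r *\<^sub>R sgn b"] r(1)
      by (subst (asm) eq1) simp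
    moreover have "8 * \<delta> < r * \<eta>"
    proof -
      have "8 * \<delta> < \<epsilon> / 4 * \<eta>" using \<delta> \<eta>(1) assms(2) by (auto simp: field_simps)
      also have "\<dots> \<le> r * \<eta>" using False \<eta>(1) by (intro mult_right_mono) auto
      finally show ?thesis .
    qed
    ultimately have "r * (2 - \<eta>) < r * norm (sgn a + sgn b)" by (simp add: algebra_simps)
    then have "2 - \<eta> < norm (sgn a + sgn b)" using r(1) by simp
    then have n: "norm (sgn a - sgn b) < \<epsilon> / (4 * R')"
      using \<eta>(2) \<open>a \<noteq> 0\<close> \<open>b \<noteq> 0\<close> by (simp add: norm_sgn)
    have "r * norm (sgn a - sgn b) \<le> R' * (\<epsilon> / (4 * R'))"
      using n r by (intro mult_mono) auto
    also have "\<dots> = \<epsilon> / 4" using r by simp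
    finally have "norm (r *\<^sub>R (sgn a - sgn b)) \<le> \<epsilon> / 4" using r(1) by simp
    moreover have eq2: "a - b = r *\<^sub>R (sgn a - sgn b) + ((a - r *\<^sub>R sgn a) - (b - r *\<^sub>R sgn b))"
      by (simp add: scaleR_diff_right)
    have "norm (a - b) \<le> norm (r *\<^sub>R (sgn a - sgn b)) + (norm (a - r *\<^sub>R sgn a) + norm (b - r *\<^sub>R sgn b))"
      by (subst eq2) (rule order.trans[OF norm_triangle_ineq add_left_mono[OF norm_triangle_ineq4]])
    ultimately show ?thesis using da db \<delta>(1,2) by linarith
  qed
  with \<delta>(1) show ?thesis by blast
qed

text \<open>After scaling to \<open>r = 1\<close>, a sum of norm at least
  \<open>2 * (1 - \<delta>)\<close> forces a difference of norm at most 1. The factor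
  \<open>\<theta>\<close> later drives the geometric decay in the midpoint construction.\<close>

lemma uniformly_convex_nonsquare:
  assumes "uniformly_convex_space TYPE('a::real_normed_vector)"
  obtains \<theta> where "0 < \<theta>" "\<theta> < 1"
    "\<And>r (a::'a) b. norm a \<le> r \<Longrightarrow> norm b \<le> r \<Longrightarrow>
       norm (a + b) \<le> 2 * (\<theta> * r) \<or> norm (a - b) \<le> 2 * (\<theta> * r)"
proof -
  obtain \<delta> where \<delta>: "\<delta> > 0"
    "\<forall>r (a::'a) b. r \<le> 1 \<and> norm a \<le> r + \<delta> \<and> norm b \<le> r + \<delta> \<and>
      2 * (r - \<delta>) \<le> norm (a + b) \<longrightarrow> norm (a - b) \<le> 1"
    using uniformly_convex_modulus[OF assms, of 1 1] by auto
  define \<theta> where "\<theta> = max (1/2) (1 - \<delta>)"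
  have \<theta>: "0 < \<theta>" "\<theta> < 1" "\<theta> \<ge> 1/2" "\<theta> \<ge> 1 - \<delta>" using \<delta>(1) by (auto simp: \<theta>_def)
  have "norm (a + b) \<le> 2 * (\<theta> * r) \<or> norm (a - b) \<le> 2 * (\<theta> * r)"
    if h: "norm a \<le> r" "norm b \<le> r" for r and a b :: 'a
  proof (cases "r = 0")
    case False
    then have r: "r > 0" using h norm_ge_zero[of a] by linarith
    have "norm (a /\<^sub>R r) \<le> 1 + \<delta>" "norm (b /\<^sub>R r) \<le> 1 + \<delta>"
      using h r \<delta>(1) by (auto simp: field_simps intro: order.trans)
    with \<delta>(2)[rule_format, of 1 "a /\<^sub>R r" "b /\<^sub>R r"]
    have "norm (a /\<^sub>R r + b /\<^sub>R r) \<le> 2 * (1 - \<delta>) \<or> norm (a /\<^sub>R r - b /\<^sub>R r) \<le> 1"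
      by linarith
    then have "norm (a /\<^sub>R r + b /\<^sub>R r) \<le> 2 * \<theta> \<or> norm (a /\<^sub>R r - b /\<^sub>R r) \<le> 2 * \<theta>"
      using \<theta>(3,4) by auto
    moreover have "norm (a /\<^sub>R r + b /\<^sub>R r) = norm (a + b) / r"
      using r norm_scaleR[of "inverse r" "a + b"] by (simp add: scaleR_add_right field_simps)
    moreover have "norm (a /\<^sub>R r - b /\<^sub>R r) = norm (a - b) / r"
      using r norm_scaleR[of "inverse r" "a - b"] by (simp add: scaleR_diff_right field_simps)
    ultimately have "norm (a + b) / r \<le> 2 * \<theta> \<or> norm (a - b) / r \<le> 2 * \<theta>"
      by metis
    then show ?thesis using r by (simp add: field_simps)
  qed (use h in auto)
  with \<theta> that show thesis by blast
qed

section \<open>Metric projections\<close>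

text \<open>A Cantor intersection argument: points picked from \<open>B (1 / real (Suc n))\<close>
  form a Cauchy sequence. It serves both for near-minimisers of a distance and for the asymptotic
  centre of an orbit.\<close>

lemma shrinking_family_limit:
  fixes B :: "real \<Rightarrow> 'a::complete_space set"
  assumes mono: "\<And>\<delta> \<delta>'. 0 < \<delta> \<Longrightarrow> \<delta> \<le> \<delta>' \<Longrightarrow> B \<delta> \<subseteq> B \<delta>'"
    and nonempty: "\<And>\<delta>. 0 < \<delta> \<Longrightarrow> B \<delta> \<noteq> {}"
    and small: "\<And>\<epsilon>. 0 < \<epsilon> \<Longrightarrow> \<exists>\<delta>>0. \<forall>u\<in>B \<delta>. \<forall>v\<in>B \<delta>. dist u v \<le> \<epsilon>"
  obtains z where "\<And>\<delta>. 0 < \<delta> \<Longrightarrow> z \<in> closure (B \<delta>)"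
proof -
  have "\<exists>z. z \<in> B (1 / real (Suc n))" for n
    by (simp add: ex_in_conv nonempty)
  then obtain s where s: "\<And>n. s n \<in> B (1 / real (Suc n))" by metis
  have tail: "\<exists>N. \<forall>n\<ge>N. s n \<in> B \<delta>" if "\<delta> > 0" for \<delta>
  proof -
    obtain N where "1 / real (Suc N) < \<delta>"
      using \<open>\<delta> > 0\<close> by (rule nat_approx_posE)
    then have "s n \<in> B \<delta>" if "n \<ge> N" for n
      using s[of n] mono[of "1 / real (Suc n)" \<delta>] that
        frac_le[of 1 1 "real (Suc N)" "real (Suc n)"] by fastforce
    then show ?thesis by blast
  qed
  have "Cauchy s"
  proof (rule metric_CauchyI)
    fix e :: real assume "e > 0"
    then obtain \<delta> where \<delta>: "\<delta> > 0" "\<forall>u\<in>B \<delta>. \<forall>v\<in>B \<delta>. dist u v \<le> e / 2"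
      using small[of "e / 2"] by auto
    with tail obtain N where "\<forall>n\<ge>N. s n \<in> B \<delta>" by blast
    with \<delta> have "\<forall>m\<ge>N. \<forall>n\<ge>N. dist (s m) (s n) \<le> e / 2" by blast
    with \<open>e > 0\<close> show "\<exists>M. \<forall>m\<ge>M. \<forall>n\<ge>M. dist (s m) (s n) < e" by fastforce
  qed
  then obtain z where z: "s \<longlonglongrightarrow> z"
    by (auto simp: Cauchy_convergent_iff convergent_def)
  have "z \<in> closure (B \<delta>)" if "\<delta> > 0" for \<delta>
    using tail[OF that] closure_subset[of "B \<delta>"]
    by (intro Lim_in_closed_set[OF closed_closure _ _ z]) (auto simp: eventually_sequentially)
  with that show thesis by blast
qed

text \<open>The midpoint of two near-minimisers stays in \<open>K\<close>, hence at distance at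
  least \<open>\<rho>\<close> from \<open>x\<close>, so the modulus brings the two together. As
  \<open>\<delta>\<close> is chosen before \<open>K\<close> and \<open>\<rho>\<close>, the estimate
  works along a sequence of sets.\<close>

lemma uniformly_convex_near_minimizers:
  fixes x :: "'a::real_normed_vector"
  assumes "uniformly_convex_space TYPE('a)" and "\<epsilon> > 0"
  shows "\<exists>\<delta>>0. \<forall>K \<rho>. convex K \<and> \<rho> \<le> R \<and> (\<forall>w\<in>K. \<rho> \<le> norm (w - x)) \<longrightarrow>
    (\<forall>u\<in>K. \<forall>v\<in>K. norm (u - x) \<le> \<rho> + \<delta> \<and> norm (v - x) \<le> \<rho> + \<delta> \<longrightarrow> norm (u - v) \<le> \<epsilon>)"
proof -
  obtain \<delta> where \<delta>: "\<delta> > 0"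
    "\<forall>r (a::'a) b. r \<le> R \<and> norm a \<le> r + \<delta> \<and> norm b \<le> r + \<delta> \<and>
      2 * (r - \<delta>) \<le> norm (a + b) \<longrightarrow> norm (a - b) \<le> \<epsilon>"
    using uniformly_convex_modulus[OF assms] by blast
  have "norm (u - v) \<le> \<epsilon>"
    if "convex K" "\<rho> \<le> R" "\<forall>w\<in>K. \<rho> \<le> norm (w - x)" "u \<in> K" "v \<in> K"
      "norm (u - x) \<le> \<rho> + \<delta>" "norm (v - x) \<le> \<rho> + \<delta>" for K \<rho> u v
  proof -
    have "midpoint u v \<in> K"
      using that convexD[OF \<open>convex K\<close>, of u v "1/2" "1/2"]
      by (simp add: midpoint_def scaleR_add_right)
    then have "\<rho> \<le> norm (midpoint u v - x)" using that by blast
    moreover have "(u - x) + (v - x) = 2 *\<^sub>R (midpoint u v - x)"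
      by (simp add: midpoint_def scaleR_diff_right scaleR_2)
    ultimately have "norm ((u - x) + (v - x)) \<ge> 2 * (\<rho> - \<delta>)"
      using \<delta>(1) by simp
    with \<delta>(2)[rule_format, of \<rho> "u - x" "v - x"] that show ?thesis by simp
  qed
  with \<delta>(1) show ?thesis by blast
qed

text \<open>The sets \<open>B \<delta>\<close> of near-minimisers shrink in diameter, so
  completeness yields a minimiser; any two minimisers lie in every \<open>B \<delta>\<close> and
  coincide.\<close>

lemma ex1_metric_projection:
  fixes K :: "'a::banach set"
  assumes uc: "uniformly_convex_space TYPE('a)" and "closed K" "convex K" "K \<noteq> {}"
  shows "\<exists>!p. is_metric_projection K x p"
proof -
  define B where "B \<delta> = K \<inter> cball x (infdist x K + \<delta>)" for \<delta>
  have dist_le: "infdist x K \<le> norm (w - x)" if "w \<in> K" for w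
    using infdist_le[OF that, of x] by (simp add: dist_norm norm_minus_commute)
  have small: "\<exists>\<delta>>0. \<forall>u\<in>B \<delta>. \<forall>v\<in>B \<delta>. dist u v \<le> \<epsilon>" if \<epsilon>: "\<epsilon> > 0" for \<epsilon>
  proof -
    obtain \<delta> where "\<delta> > 0" and \<delta>: "\<forall>A \<rho>. convex A \<and> \<rho> \<le> infdist x K \<and> (\<forall>w\<in>A. \<rho> \<le> norm (w - x)) \<longrightarrow>
      (\<forall>u\<in>A. \<forall>v\<in>A. norm (u - x) \<le> \<rho> + \<delta> \<and> norm (v - x) \<le> \<rho> + \<delta> \<longrightarrow> norm (u - v) \<le> \<epsilon>)"
      using uniformly_convex_near_minimizers[OF uc \<epsilon>] by blast
    have "norm (u - v) \<le> \<epsilon>" if "u \<in> B \<delta>" "v \<in> B \<delta>" for u v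
      using that dist_le \<open>convex K\<close> \<delta>[rule_format, of K "infdist x K" u v]
      by (simp add: B_def dist_norm norm_minus_commute)
    with \<open>\<delta> > 0\<close> show ?thesis by (auto simp: dist_norm)
  qed
  have nonempty: "B \<delta> \<noteq> {}" if "\<delta> > 0" for \<delta>
  proof -
    have "(INF a\<in>K. dist x a) < infdist x K + \<delta>"
      using that \<open>K \<noteq> {}\<close> by (simp add: infdist_notempty)
    then obtain a where "a \<in> K" "dist x a < infdist x K + \<delta>"
      using \<open>K \<noteq> {}\<close> by (subst (asm) cINF_less_iff) auto
    then show ?thesis by (auto simp: B_def)
  qed
  have mono: "B \<delta> \<subseteq> B \<delta>'" if "0 < \<delta>" "\<delta> \<le> \<delta>'" for \<delta> \<delta>'
    using that by (auto simp: B_def)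
  obtain p where "\<And>\<delta>. 0 < \<delta> \<Longrightarrow> p \<in> closure (B \<delta>)"
    using shrinking_family_limit[of B, OF mono nonempty small] by metis
  then have "p \<in> B \<delta>" if "\<delta> > 0" for \<delta>
    using that \<open>closed K\<close> by (simp add: B_def closure_closed closed_Int)
  then have pK: "p \<in> K" and p_le: "\<And>\<delta>. \<delta> > 0 \<Longrightarrow> norm (p - x) \<le> infdist x K + \<delta>"
    by (auto simp: B_def dist_norm norm_minus_commute intro: zero_less_one)
  have "norm (p - x) \<le> infdist x K" using p_le by (rule field_le_epsilon)
  with pK dist_le have p: "is_metric_projection K x p"
    unfolding is_metric_projection_def by (meson order.trans)
  show ?thesis
  proof (rule ex1I)
    show "is_metric_projection K x p" by (rule p)
  next
    fix p' assume p': "is_metric_projection K x p'"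
    have in_B: "q \<in> B \<delta>" if "is_metric_projection K x q" "\<delta> > 0" for q \<delta>
      using that pK \<open>norm (p - x) \<le> infdist x K\<close>
      by (fastforce simp: is_metric_projection_def B_def dist_norm norm_minus_commute)
    have "dist p' p \<le> 0 + \<epsilon>" if "\<epsilon> > 0" for \<epsilon>
      using small[OF that] in_B p p' by auto
    then have "dist p' p \<le> 0" by (rule field_le_epsilon)
    then show "p' = p" by simp
  qed
qed

lemma is_metric_projection_metric_projection:
  fixes K :: "'a::banach set"
  assumes "uniformly_convex_space TYPE('a)" "closed K" "convex K" "K \<noteq> {}"
  shows "is_metric_projection K x (metric_projection K x)"
  unfolding metric_projection_def by (rule theI'[OF ex1_metric_projection[OF assms]])

text \<open>The distances \<open>r n\<close> increase to a limit \<open>L\<close>. For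
  \<open>m \<ge> N\<close> the point \<open>y m\<close> lies in \<open>K N\<close> and exceeds the
  minimal distance \<open>r N\<close> by at most \<open>L - r N\<close>, so the tail consists of
  near-minimisers over a single set.\<close>

lemma metric_projection_decseq_tendsto:
  fixes K :: "nat \<Rightarrow> 'a::banach set"
  assumes uc: "uniformly_convex_space TYPE('a)"
    and K: "\<And>n. closed (K n)" "\<And>n. convex (K n)" "decseq K" "(\<Inter>n. K n) \<noteq> {}"
    and y: "\<And>n. is_metric_projection (K n) x (y n)"
  obtains q where "y \<longlonglongrightarrow> q" "is_metric_projection (\<Inter>n. K n) x q"
proof -
  define r where "r n = norm (y n - x)" for n
  have yK: "y m \<in> K n" if "n \<le> m" for m n
    using y[of m] decseqD[OF K(3) that] by (auto simp: is_metric_projection_def)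
  have r_le: "r n \<le> norm (w - x)" if "w \<in> K n" for w n
    using y[of n] that by (auto simp: r_def is_metric_projection_def)
  obtain p where p: "\<And>n. p \<in> K n" using K(4) by auto
  have "incseq r" using r_le yK by (auto simp: incseq_def r_def)
  moreover have "\<And>n. r n \<le> norm (p - x)" using r_le p by blast
  ultimately obtain L where L: "r \<longlonglongrightarrow> L" "\<forall>n. r n \<le> L"
    using incseq_convergent[of r "norm (p - x)"] by blast
  have "Cauchy y"
  proof (rule metric_CauchyI)
    fix e :: real assume "e > 0"
    then have "e / 2 > 0" by simp
    obtain \<delta> where "\<delta> > 0" and \<delta>: "\<forall>A \<rho>. convex A \<and> \<rho> \<le> L \<and> (\<forall>w\<in>A. \<rho> \<le> norm (w - x)) \<longrightarrow>
      (\<forall>u\<in>A. \<forall>v\<in>A. norm (u - x) \<le> \<rho> + \<delta> \<and> norm (v - x) \<le> \<rho> + \<delta> \<longrightarrow> norm (u - v) \<le> e / 2)"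
      using uniformly_convex_near_minimizers[OF uc \<open>e / 2 > 0\<close>] by blast
    from \<open>\<delta> > 0\<close> have "\<forall>\<^sub>F n in sequentially. L - \<delta> < r n"
      using order_tendstoD(1)[OF L(1)] by simp
    then obtain N where N: "L - \<delta> < r N" by (auto simp: eventually_sequentially)
    have "dist (y m) (y n) \<le> e / 2" if "m \<ge> N" "n \<ge> N" for m n
    proof -
      have "norm (y m - x) \<le> r N + \<delta>" "norm (y n - x) \<le> r N + \<delta>"
        using L(2)[rule_format, of m] L(2)[rule_format, of n] N by (auto simp: r_def)
      then show ?thesis
        using \<delta>[rule_format, of "K N" "r N" "y m" "y n"] K(2) L(2) r_le yK that
        by (simp add: dist_norm)
    qed
    with \<open>e > 0\<close> show "\<exists>M. \<forall>m\<ge>M. \<forall>n\<ge>M. dist (y m) (y n) < e" by fastforce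
  qed
  then obtain q where q: "y \<longlonglongrightarrow> q"
    by (auto simp: Cauchy_convergent_iff convergent_def)
  have "q \<in> K n" for n
    using yK by (intro Lim_in_closed_set[OF K(1) _ _ q]) (auto simp: eventually_sequentially)
  moreover have "r \<longlonglongrightarrow> norm (q - x)" unfolding r_def by (intro tendsto_intros q)
  then have "norm (q - x) \<le> norm (w - x)" if "\<And>n. w \<in> K n" for w
    using that r_le by (intro LIMSEQ_le_const2) auto
  ultimately have "is_metric_projection (\<Inter>n. K n) x q"
    by (auto simp: is_metric_projection_def)
  with q that show thesis by blast
qed

section \<open>Smoothness and the duality map\<close>

text \<open>The directional derivative of the norm at \<open>u\<close> is subadditive because the
  norm is convex, and homogeneous even for negative factors because the limit is two-sided; together
  this makes it linear.\<close>

lemma smooth_space_norm_derivative: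
  fixes u :: "'a::real_normed_vector"
  assumes "smooth_space TYPE('a)" and u: "norm u = 1"
  obtains f :: "'a \<Rightarrow>\<^sub>L real" where
    "\<And>z. ((\<lambda>t. (norm (u + t *\<^sub>R z) - 1) / t) \<longlongrightarrow> f z) (at 0)" "norm f = 1" "f u = 1"
proof -
  have nz: "\<forall>\<^sub>F t::real in at 0. t \<noteq> 0" by (simp add: eventually_at_filter)
  define D where "D z t = (norm (u + t *\<^sub>R z) - 1) / t" for z t
  have scale: "(D (c *\<^sub>R w) \<longlongrightarrow> c * l) (at 0)" if "(D w \<longlongrightarrow> l) (at 0)" for c w l
  proof (cases "c = 0")
    case True
    then show ?thesis using u by (simp add: D_def[abs_def])
  next
    case False
    have "filterlim (\<lambda>t. t * c) (at 0) (at 0)"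
      using False nz by (auto intro!: filterlim_atI tendsto_eq_intros elim: eventually_mono)
    from filterlim_compose[OF that this] have "((\<lambda>t. c * D w (t * c)) \<longlongrightarrow> c * l) (at 0)"
      by (intro tendsto_intros)
    moreover have "c * D w (t * c) = D (c *\<^sub>R w) t" for t
      using False by (simp add: D_def)
    ultimately show ?thesis by simp
  qed
  have "\<exists>l. (D z \<longlongrightarrow> l) (at 0)" for z
  proof (cases "z = 0")
    case False
    then have "norm (sgn z) = 1" by (simp add: norm_sgn)
    with assms obtain l where "(D (sgn z) \<longlongrightarrow> l) (at 0)"
      unfolding smooth_space_def D_def by metis
    from scale[OF this, of "norm z"] False show ?thesis by (auto simp: sgn_div_norm)
  qed (use u in \<open>auto simp: D_def[abs_def]\<close>)
  then obtain f where f: "\<And>z. (D z \<longlongrightarrow> f z) (at 0)" by metis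
  have f_scale: "f (c *\<^sub>R z) = c * f z" for c z
    using tendsto_unique[OF _ f scale[OF f]] by simp
  have sub: "f (z + w) \<le> f z + f w" for z w
  proof -
    have lim: "(D z' \<longlongrightarrow> f z') (at_right 0)" for z'
      using f by (rule tendsto_within_subset) simp
    \<comment> \<open>The point reached in direction \<open>z + w\<close> is the midpoint of those
      reached in directions \<open>2 *\<^sub>R z\<close> and \<open>2 *\<^sub>R w\<close>. Staying
      with \<open>t > 0\<close> preserves the inequality under division.\<close>
    have "\<forall>\<^sub>F t in at_right 0. D (z + w) t \<le> D (2 *\<^sub>R z) t / 2 + D (2 *\<^sub>R w) t / 2"
      unfolding eventually_at_filter
    proof (intro always_eventually allI impI)
      fix t :: real assume "t \<in> {0<..}"
      then have "t > 0" by simp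
      have "2 *\<^sub>R (u + t *\<^sub>R (z + w)) = (u + t *\<^sub>R (2 *\<^sub>R z)) + (u + t *\<^sub>R (2 *\<^sub>R w))"
        by (simp add: algebra_simps scaleR_2[of u])
      then have "2 * norm (u + t *\<^sub>R (z + w)) \<le> norm (u + t *\<^sub>R (2 *\<^sub>R z)) + norm (u + t *\<^sub>R (2 *\<^sub>R w))"
        using norm_triangle_ineq[of "u + t *\<^sub>R (2 *\<^sub>R z)" "u + t *\<^sub>R (2 *\<^sub>R w)"]
          norm_scaleR[of 2 "u + t *\<^sub>R (z + w)"] by simp
      then have "norm (u + t *\<^sub>R (z + w)) - 1
          \<le> (norm (u + t *\<^sub>R (2 *\<^sub>R z)) - 1) / 2 + (norm (u + t *\<^sub>R (2 *\<^sub>R w)) - 1) / 2"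
        by argo
      from divide_right_mono[OF this, of t] \<open>t > 0\<close>
      show "D (z + w) t \<le> D (2 *\<^sub>R z) t / 2 + D (2 *\<^sub>R w) t / 2"
        unfolding D_def by (simp only: add_divide_distrib divide_divide_eq_left mult.commute less_imp_le)
    qed
    then have "f (z + w) \<le> f (2 *\<^sub>R z) / 2 + f (2 *\<^sub>R w) / 2"
      by (intro tendsto_le[OF _ _ lim]) (auto intro!: tendsto_intros lim)
    then show ?thesis by (simp add: f_scale)
  qed
  \<comment> \<open>Subadditivity at \<open>z + w\<close> and \<open>- w\<close> supplies the
    reverse inequality.\<close>
  have add: "f (z + w) = f z + f w" for z w
    using sub[of z w] sub[of "z + w" "- w"] f_scale[of "-1" w] by simp
  have bound: "\<bar>f z\<bar> \<le> norm z" for z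
  proof (rule tendsto_upperbound)
    show "((\<lambda>t. \<bar>D z t\<bar>) \<longlongrightarrow> \<bar>f z\<bar>) (at 0)" by (intro tendsto_intros f)
    show "\<forall>\<^sub>F t in at 0. \<bar>D z t\<bar> \<le> norm z"
      using nz
    proof eventually_elim
      case (elim t)
      then show ?case
        using norm_triangle_ineq3[of "u + t *\<^sub>R z" u] u by (simp add: D_def field_simps)
    qed
  qed simp
  define F where "F = Blinfun f"
  have "bounded_linear f"
    by (rule bounded_linear_intro[of _ 1]) (auto simp: add f_scale bound)
  then have F: "blinfun_apply F = f" by (simp add: F_def bounded_linear_Blinfun_apply)
  have "(D u \<longlongrightarrow> 1) (at 0)"
  proof (rule tendsto_eventually)
    show "\<forall>\<^sub>F t in at 0. D u t = 1"
      unfolding eventually_at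
    proof (intro exI[of _ 1] conjI ballI impI)
      fix t :: real assume "t \<noteq> 0 \<and> dist t 0 < 1"
      moreover have "norm (u + t *\<^sub>R u) = \<bar>1 + t\<bar>"
        using norm_scaleR[of "1 + t" u] u by (simp add: scaleR_add_left)
      ultimately show "D u t = 1" by (simp add: D_def abs_if split: if_splits)
    qed simp
  qed
  then have fu: "f u = 1" using f tendsto_unique[of "at (0::real)"] by force
  have "norm F \<le> 1" by (rule norm_blinfun_bound) (auto simp: F bound)
  moreover have "1 \<le> norm F" using norm_blinfun[of F u] fu u by (simp add: F)
  ultimately have "norm F = 1" by simp
  show thesis
  proof (rule that)
    show "((\<lambda>t. (norm (u + t *\<^sub>R z) - 1) / t) \<longlongrightarrow> F z) (at 0)" for z
      using f[of z] by (simp add: D_def[abs_def] F)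
    show "norm F = 1" by fact
    show "F u = 1" using fu by (simp add: F)
  qed
qed

text \<open>The Gateaux derivative of the norm provides the duality functional, so that no
  Hahn-Banach theorem is needed.\<close>

lemma smooth_space_duality_map:
  fixes y :: "'a::real_normed_vector"
  assumes "smooth_space TYPE('a)" and "y \<noteq> 0"
  shows "((\<lambda>t. norm y * ((norm (sgn y + t *\<^sub>R z) - 1) / t)) \<longlongrightarrow> duality_map y z) (at 0)"
proof -
  define u where "u = sgn y"
  have u: "norm u = 1" "norm y *\<^sub>R u = y"
    using assms(2) by (auto simp: u_def norm_sgn sgn_div_norm)
  obtain f :: "'a \<Rightarrow>\<^sub>L real" where
    f: "\<And>z. ((\<lambda>t. (norm (u + t *\<^sub>R z) - 1) / t) \<longlongrightarrow> f z) (at 0)" "norm f = 1" "f u = 1"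
    using smooth_space_norm_derivative[OF assms(1) u(1)] by blast
  have "blinfun_apply f y = norm y"
    using f(3) u(2) blinfun.scaleR_right[of f "norm y" u] by simp
  then have ds: "norm y *\<^sub>R f \<in> duality_set y"
    using f(2) by (simp add: duality_set_def blinfun.scaleR_left power2_eq_square)
  moreover have "g = norm y *\<^sub>R f" if "g \<in> duality_set y" for g
  proof -
    have g: "norm g = norm y" "g y = (norm y)\<^sup>2"
      using that by (auto simp: duality_set_def)
    have gu: "g u = norm y"
      using g(2) u(2) assms(2) blinfun.scaleR_right[of g "norm y" u] by (simp add: power2_eq_square)
    \<comment> \<open>The functional \<open>g\<close> has norm \<open>norm y\<close> and attains it
      at \<open>u\<close>, so \<open>g z\<close> lies below every right difference quotient. Using
      \<open>- z\<close> as well turns the bound into equality, which gives uniqueness.\<close>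
    have le: "g z \<le> norm y * f z" for z
    proof (rule tendsto_lowerbound)
      show "((\<lambda>t. norm y * ((norm (u + t *\<^sub>R z) - 1) / t)) \<longlongrightarrow> norm y * f z) (at_right 0)"
        by (intro tendsto_intros tendsto_within_subset[OF f(1)]) simp
      show "\<forall>\<^sub>F t in at_right 0. g z \<le> norm y * ((norm (u + t *\<^sub>R z) - 1) / t)"
        unfolding eventually_at_filter
      proof (intro always_eventually allI impI)
        fix t :: real assume "t \<in> {0<..}"
        moreover have "g (u + t *\<^sub>R z) \<le> norm y * norm (u + t *\<^sub>R z)"
          using norm_blinfun[of g "u + t *\<^sub>R z"] g(1) by simp
        ultimately show "g z \<le> norm y * ((norm (u + t *\<^sub>R z) - 1) / t)"
          using gu by (simp add: blinfun.add_right blinfun.scaleR_right field_simps)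
      qed
    qed simp
    show ?thesis
    proof (rule blinfun_eqI)
      fix z
      show "g z = (norm y *\<^sub>R f) z"
        using le[of z] le[of "- z"] by (simp add: blinfun.minus_right blinfun.scaleR_left)
    qed
  qed
  ultimately have "duality_map y = norm y *\<^sub>R f"
    unfolding duality_map_def by (rule the_equality)
  then show ?thesis
    using tendsto_mult_left[OF f(1)] by (simp add: u_def blinfun.scaleR_left)
qed

text \<open>Covers the case \<open>x = p\<close>, where the norm has no derivative to use; it occurs
  at the first iterate, which is \<open>x\<close> itself.\<close>

lemma duality_map_0: "duality_map (0 :: 'a::real_normed_vector) = 0"
proof -
  have "duality_set (0::'a) = {0}" by (auto simp: duality_set_def)
  then show ?thesis by (simp add: duality_map_def)
qed

text \<open>Moving from \<open>p\<close> towards \<open>z\<close> stays in \<open>K\<close> and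
  cannot shorten the distance to \<open>x\<close>. So the norm has a nonnegative derivative at
  \<open>x - p\<close> in direction \<open>p - z\<close>, and the duality functional is a positive
  multiple of that derivative.\<close>

lemma metric_projection_duality_nonneg:
  fixes K :: "'a::real_normed_vector set"
  assumes "smooth_space TYPE('a)" and "convex K" and p: "is_metric_projection K x p" and "z \<in> K"
  shows "0 \<le> blinfun_apply (duality_map (x - p)) (p - z)"
proof (cases "x = p")
  case True
  then show ?thesis by (simp add: duality_map_0)
next
  case False
  define y where "y = x - p"
  have "y \<noteq> 0" using False by (simp add: y_def)
  have "0 \<le> duality_map y (p - z)"
  proof (rule tendsto_lowerbound)
    show "((\<lambda>t. norm y * ((norm (sgn y + t *\<^sub>R (p - z)) - 1) / t)) \<longlongrightarrow> duality_map y (p - z)) (at_right 0)"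
      by (rule tendsto_within_subset[OF smooth_space_duality_map[OF assms(1) \<open>y \<noteq> 0\<close>]]) simp
    have "\<forall>\<^sub>F t in at_right 0. t \<in> {0<..<inverse (norm y)}"
      using \<open>y \<noteq> 0\<close> by (intro eventually_at_right_real) simp
    then show "\<forall>\<^sub>F t in at_right 0. 0 \<le> norm y * ((norm (sgn y + t *\<^sub>R (p - z)) - 1) / t)"
    proof eventually_elim
      case (elim t)
      \<comment> \<open>The quotient is taken at \<open>sgn y\<close>, so a step \<open>t\<close>
        there is a step \<open>norm y * t\<close> of the convex combination.\<close>
      define s where "s = norm y * t"
      have s: "0 \<le> s" "s \<le> 1" using elim \<open>y \<noteq> 0\<close> by (auto simp: s_def field_simps)
      have "p \<in> K" using p by (simp add: is_metric_projection_def)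
      then have "(1 - s) *\<^sub>R p + s *\<^sub>R z \<in> K"
        using \<open>convex K\<close> \<open>z \<in> K\<close> s by (intro convexD) auto
      then have "norm y \<le> norm ((1 - s) *\<^sub>R p + s *\<^sub>R z - x)"
        using p by (simp add: is_metric_projection_def y_def norm_minus_commute[of x p])
      also have "(1 - s) *\<^sub>R p + s *\<^sub>R z - x = - (norm y *\<^sub>R (sgn y + t *\<^sub>R (p - z)))"
        using \<open>y \<noteq> 0\<close> by (simp add: sgn_div_norm s_def algebra_simps) (simp add: y_def)
      also have "norm \<dots> = norm y * norm (sgn y + t *\<^sub>R (p - z))" by simp
      finally show ?case using \<open>y \<noteq> 0\<close> elim by simp
    qed
  qed simp
  then show ?thesis by (simp add: y_def)
qed

section \<open>Convex hulls by iterated midpoints\<close>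

text \<open>If the segment left \<open>S\<close> at parameter \<open>t\<close>, closedness would
  give nearest parameters \<open>a < t < b\<close> inside \<open>S\<close>; but
  \<open>(a + b) / 2\<close> also belongs to \<open>S\<close> and lies strictly between
  them.\<close>

lemma closed_midpoint_convex:
  fixes S :: "'a::real_normed_vector set"
  assumes "closed S" and mid: "\<And>u v. u \<in> S \<Longrightarrow> v \<in> S \<Longrightarrow> midpoint u v \<in> S"
  shows "convex S"
  unfolding convex_alt
proof (intro ballI allI impI, elim conjE, rule ccontr)
  fix u v and t :: real
  assume uv: "u \<in> S" "v \<in> S" and t: "0 \<le> t" "t \<le> 1"
  define g where "g s = (1 - s) *\<^sub>R u + s *\<^sub>R v" for s :: real
  assume "(1 - t) *\<^sub>R u + t *\<^sub>R v \<notin> S"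
  then have tS: "g t \<notin> S" by (simp add: g_def)
  define I where "I = g -` S"
  have "closed I" unfolding I_def g_def
    by (intro closed_vimage \<open>closed S\<close> continuous_intros)
  have I01: "0 \<in> I" "1 \<in> I" using uv by (auto simp: I_def g_def)
  have "Sup (I \<inter> {..t}) \<in> I \<inter> {..t}"
    using I01 t \<open>closed I\<close> by (intro closed_contains_Sup) (auto intro: bdd_above_mono[of "{..t}"])
  moreover have "Inf (I \<inter> {t..}) \<in> I \<inter> {t..}"
    using I01 t \<open>closed I\<close> by (intro closed_contains_Inf) (auto intro: bdd_below_mono[of "{t..}"])
  ultimately obtain a b where a: "a \<in> I" "a \<le> t" "a = Sup (I \<inter> {..t})"
    and b: "b \<in> I" "t \<le> b" "b = Inf (I \<inter> {t..})" by blast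
  have "a \<noteq> t" "b \<noteq> t" using a b tS by (auto simp: I_def)
  with a b have "a < t" "t < b" by auto
  have e: "1 - (a + b) / 2 = inverse 2 * (1 - a) + inverse 2 * (1 - b)"
      "(a + b) / 2 = inverse 2 * a + inverse 2 * b"
    by (simp_all add: field_simps)
  have "g ((a + b) / 2) = (inverse 2 * (1 - a) + inverse 2 * (1 - b)) *\<^sub>R u
      + (inverse 2 * a + inverse 2 * b) *\<^sub>R v"
    by (simp only: g_def e[symmetric])
  also have "\<dots> = midpoint (g a) (g b)"
    by (simp only: g_def midpoint_def scaleR_add_left scaleR_add_right scaleR_scaleR add_ac)
  finally have "g ((a + b) / 2) = midpoint (g a) (g b)" .
  then have c: "(a + b) / 2 \<in> I" using mid a b by (simp add: I_def)
  show False
  proof (cases "(a + b) / 2 \<le> t")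
    case True
    then have "(a + b) / 2 \<le> a" unfolding a(3)
      using c by (intro cSup_upper) (auto intro: bdd_above_mono[of "{..t}"] simp flip: a(3))
    with \<open>a < t\<close> \<open>t < b\<close> show False by simp
  next
    case False
    then have "b \<le> (a + b) / 2" unfolding b(3)
      using c by (intro cInf_lower) (auto intro: bdd_below_mono[of "{t..}"] simp flip: b(3))
    with \<open>a < t\<close> \<open>t < b\<close> show False by simp
  qed
qed

text \<open>Level \<open>k\<close> consists of the averages of \<open>2 ^ k\<close> points of
  \<open>M\<close>, repetitions allowed. Levels count how often a midpoint estimate has to be
  applied.\<close>

primrec iterated_midpoints :: "'a::real_vector set \<Rightarrow> nat \<Rightarrow> 'a set" where
  "iterated_midpoints M 0 = M"
| "iterated_midpoints M (Suc k) =
     {midpoint a b |a b. a \<in> iterated_midpoints M k \<and> b \<in> iterated_midpoints M k}"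

lemma iterated_midpoints_le_Suc: "iterated_midpoints M k \<subseteq> iterated_midpoints M (Suc k)"
proof
  fix a assume "a \<in> iterated_midpoints M k"
  then have "midpoint a a \<in> iterated_midpoints M (Suc k)"
    unfolding iterated_midpoints.simps by blast
  then show "a \<in> iterated_midpoints M (Suc k)" by (simp only: midpoint_idem)
qed

lemma iterated_midpoints_mono_index:
  "k \<le> m \<Longrightarrow> iterated_midpoints M k \<subseteq> iterated_midpoints M m"
  using lift_Suc_mono_le[of "iterated_midpoints M" k m, OF iterated_midpoints_le_Suc] .

lemma iterated_midpoints_mono:
  "M \<subseteq> N \<Longrightarrow> iterated_midpoints M k \<subseteq> iterated_midpoints N k"
  by (induction k) auto

text \<open>Points of different levels can be lifted to a common level, so the closure on the right
  contains midpoints and is convex by \<open>closed_midpoint_convex\<close>.\<close>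

lemma convex_hull_subset_closure_iterated_midpoints:
  fixes M :: "'a::real_normed_vector set"
  shows "closure (convex hull M) \<subseteq> closure (\<Union>k. iterated_midpoints M k)"
proof (intro closure_minimal hull_minimal closed_midpoint_convex)
  let ?U = "\<Union>k. iterated_midpoints M k"
  show "M \<subseteq> closure ?U"
    using closure_subset[of ?U] iterated_midpoints.simps(1)[of M] by blast
  have mid: "midpoint u v \<in> ?U" if uv: "u \<in> ?U" "v \<in> ?U" for u v
  proof -
    obtain k m where "u \<in> iterated_midpoints M k" "v \<in> iterated_midpoints M m" using uv by auto
    then have "u \<in> iterated_midpoints M (max k m)" "v \<in> iterated_midpoints M (max k m)"
      using iterated_midpoints_mono_index[of k "max k m" M] iterated_midpoints_mono_index[of m "max k m" M]
      by auto
    then have "midpoint u v \<in> iterated_midpoints M (Suc (max k m))" by auto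
    then show ?thesis by blast
  qed
  fix u v assume "u \<in> closure ?U" "v \<in> closure ?U"
  then obtain a b where "\<And>n. a n \<in> ?U" "a \<longlonglongrightarrow> u" "\<And>n. b n \<in> ?U" "b \<longlonglongrightarrow> v"
    unfolding closure_sequential by metis
  then have "(\<lambda>n. midpoint (a n) (b n)) \<longlonglongrightarrow> midpoint u v" "\<And>n. midpoint (a n) (b n) \<in> ?U"
    using mid by (auto simp: midpoint_def intro!: tendsto_intros)
  then show "midpoint u v \<in> closure ?U"
    unfolding closure_sequential by (intro exI[of _ "\<lambda>n. midpoint (a n) (b n)"] conjI allI)
qed auto

text \<open>Each of the two midpoints in the induction step can be re-paired in two ways;
  nonsquareness makes the difference of one of the pairings shorter by the factor \<open>\<theta>\<close>.\<close>

lemma iterated_midpoints_halving: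
  fixes M :: "'a::real_normed_vector set"
  assumes \<theta>: "\<And>r (a::'a) b. norm a \<le> r \<Longrightarrow> norm b \<le> r \<Longrightarrow>
       norm (a + b) \<le> 2 * (\<theta> * r) \<or> norm (a - b) \<le> 2 * (\<theta> * r)"
    and d: "\<And>u v. u \<in> M \<Longrightarrow> v \<in> M \<Longrightarrow> norm (u - v) \<le> d"
    and "a \<in> iterated_midpoints M (Suc m)"
  shows "\<exists>b b'. b \<in> iterated_midpoints M m \<and> b' \<in> iterated_midpoints M m \<and> a = midpoint b b'
    \<and> norm (b - b') \<le> \<theta> ^ m * d"
  using assms(3)
proof (induction m arbitrary: a)
  case 0
  then show ?case using d by fastforce
next
  case (Suc m)
  then obtain a1 a2 where a: "a = midpoint a1 a2" "a1 \<in> iterated_midpoints M (Suc m)"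
      "a2 \<in> iterated_midpoints M (Suc m)"
    by auto
  obtain b1 c1 where 1: "b1 \<in> iterated_midpoints M m" "c1 \<in> iterated_midpoints M m" "a1 = midpoint b1 c1"
      "norm (b1 - c1) \<le> \<theta> ^ m * d" using Suc.IH[OF a(2)] by blast
  obtain b2 c2 where 2: "b2 \<in> iterated_midpoints M m" "c2 \<in> iterated_midpoints M m" "a2 = midpoint b2 c2"
      "norm (b2 - c2) \<le> \<theta> ^ m * d" using Suc.IH[OF a(3)] by blast
  have in_Suc: "midpoint p q \<in> iterated_midpoints M (Suc m)"
    if "p \<in> iterated_midpoints M m" "q \<in> iterated_midpoints M m" for p q
    using that by auto
  have diff: "norm (midpoint p q - midpoint p' q') = norm ((p - p') + (q - q')) / 2" for p q p' q' :: 'a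
  proof -
    have "midpoint p q - midpoint p' q' = (1/2) *\<^sub>R ((p - p') + (q - q'))"
      by (simp add: midpoint_def algebra_simps)
    then show ?thesis by simp
  qed
  \<comment> \<open>The two pairings differ by half the sum and half the difference of
    \<open>b1 - c1\<close> and \<open>b2 - c2\<close>, the vectors that \<open>\<theta>\<close>
    controls.\<close>
  have pair: "a = midpoint (midpoint b1 b2) (midpoint c1 c2)" "a = midpoint (midpoint b1 c2) (midpoint c1 b2)"
    unfolding a(1) 1(3) 2(3) by (simp_all add: midpoint_def algebra_simps)
  from \<theta>[OF 1(4) 2(4)] show ?case
  proof
    assume "norm ((b1 - c1) + (b2 - c2)) \<le> 2 * (\<theta> * (\<theta> ^ m * d))"
    then have "norm (midpoint b1 b2 - midpoint c1 c2) \<le> \<theta> ^ Suc m * d" by (simp add: diff mult.assoc)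
    with pair(1) in_Suc 1 2 show ?thesis by blast
  next
    assume "norm ((b1 - c1) - (b2 - c2)) \<le> 2 * (\<theta> * (\<theta> ^ m * d))"
    then have "norm (midpoint b1 c2 - midpoint c1 b2) \<le> \<theta> ^ Suc m * d"
      by (simp add: diff mult.assoc algebra_simps)
    with pair(2) in_Suc 1 2 show ?thesis by blast
  qed
qed

text \<open>Descending from level \<open>Suc m\<close> to a point given by
  \<open>iterated_midpoints_halving\<close> costs at most \<open>\<theta> ^ m * d\<close>, and these
  costs sum to a geometric tail. The bound does not depend on the original level.\<close>

lemma iterated_midpoints_approx:
  fixes M :: "'a::real_normed_vector set"
  assumes \<theta>: "0 < \<theta>" "\<theta> < 1" "\<And>r (a::'a) b. norm a \<le> r \<Longrightarrow> norm b \<le> r \<Longrightarrow>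
       norm (a + b) \<le> 2 * (\<theta> * r) \<or> norm (a - b) \<le> 2 * (\<theta> * r)"
    and d: "\<And>u v. u \<in> M \<Longrightarrow> v \<in> M \<Longrightarrow> norm (u - v) \<le> d" and "d \<ge> 0"
    and "a \<in> iterated_midpoints M m"
  shows "\<exists>b\<in>iterated_midpoints M k. norm (a - b) \<le> \<theta> ^ k * d / (1 - \<theta>)"
proof (cases "m \<le> k")
  case True
  with assms(6) iterated_midpoints_mono_index[OF True, of M] \<theta>(1,2) \<open>d \<ge> 0\<close> show ?thesis
    by (intro bexI[of _ a]) auto
next
  case False
  then have "k \<le> m" by simp
  \<comment> \<open>The induction carries the exact partial sum of the geometric series, over
    exponents from \<open>k\<close> to \<open>m - 1\<close>.\<close>
  then have "\<exists>b\<in>iterated_midpoints M k. norm (a - b) \<le> (\<theta> ^ k - \<theta> ^ m) * d / (1 - \<theta>)"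
    using assms(6)
  proof (induction m arbitrary: a rule: dec_induct)
    case base
    then show ?case by (intro bexI[of _ a]) auto
  next
    case (step m)
    obtain b b' where b: "b \<in> iterated_midpoints M m" "a = midpoint b b'" "norm (b - b') \<le> \<theta> ^ m * d"
      using iterated_midpoints_halving[OF \<theta>(3) d step.prems] by blast
    obtain c where c: "c \<in> iterated_midpoints M k" "norm (b - c) \<le> (\<theta> ^ k - \<theta> ^ m) * d / (1 - \<theta>)"
      using step.IH[OF b(1)] by blast
    have "norm (a - b) = norm (b - b') / 2"
      using dist_midpoint(1)[of b b'] dist_midpoint(3)[of b b']
      by (simp add: b(2) dist_norm norm_minus_commute)
    then have "norm (a - b) \<le> \<theta> ^ m * d" using b(3) norm_ge_zero[of "b - b'"] by linarith
    then have "norm (a - c) \<le> \<theta> ^ m * d + (\<theta> ^ k - \<theta> ^ m) * d / (1 - \<theta>)"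
      using c(2) norm_triangle_ineq[of "a - b" "b - c"] by simp
    also have "\<dots> = (\<theta> ^ k - \<theta> ^ Suc m) * d / (1 - \<theta>)"
      using \<theta>(2) by (simp add: field_simps)
    finally show ?case using c(1) by blast
  qed
  moreover have "(\<theta> ^ k - \<theta> ^ m) * d / (1 - \<theta>) \<le> \<theta> ^ k * d / (1 - \<theta>)"
    using \<theta>(1,2) \<open>d \<ge> 0\<close> by (intro divide_right_mono mult_right_mono) auto
  ultimately show ?thesis by (meson order_trans)
qed

section \<open>Approximate fixed points and convex combinations\<close>

text \<open>The image \<open>S m\<close> of the midpoint is within \<open>r + \<eta>\<close> of both
  \<open>u\<close> and \<open>v\<close>, which are \<open>2 * r\<close> apart. Uniform convexity
  then forces \<open>S m - u\<close> and \<open>v - S m\<close> to be nearly equal, which puts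
  \<open>S m\<close> near \<open>m\<close>.\<close>

lemma midpoint_approximate_fixed_point:
  fixes C :: "'a::real_normed_vector set"
  assumes uc: "uniformly_convex_space TYPE('a)" and C: "convex C" "bounded C" and "\<epsilon> > 0"
  shows "\<exists>\<delta>>0. \<forall>S. (\<forall>u\<in>C. \<forall>v\<in>C. norm (S u - S v) \<le> (1 + \<delta>) * norm (u - v)) \<longrightarrow>
    (\<forall>u\<in>C. \<forall>v\<in>C. norm (u - S u) \<le> \<delta> \<and> norm (v - S v) \<le> \<delta> \<longrightarrow>
      norm (midpoint u v - S (midpoint u v)) \<le> \<epsilon>)"
proof -
  define d where "d = diameter C"
  have "d \<ge> 0" using C by (simp add: d_def diameter_ge_0)
  have d: "norm (u - v) \<le> d" if "u \<in> C" "v \<in> C" for u v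
    using diameter_bounded_bound[OF C(2) that] by (simp add: d_def dist_norm)
  obtain \<eta> where \<eta>: "\<eta> > 0"
    "\<forall>r (a::'a) b. r \<le> d \<and> norm a \<le> r + \<eta> \<and> norm b \<le> r + \<eta> \<and>
      2 * (r - \<eta>) \<le> norm (a + b) \<longrightarrow> norm (a - b) \<le> 2 * \<epsilon>"
    using uniformly_convex_modulus[OF uc, of "2 * \<epsilon>" d] \<open>\<epsilon> > 0\<close> by auto
  \<comment> \<open>The Lipschitz excess and the fixed point error add up to
    \<open>\<delta> * (r + 1)\<close>, and \<open>r \<le> d\<close>.\<close>
  define \<delta> where "\<delta> = \<eta> / (d + 1)"
  have \<delta>: "\<delta> > 0" "\<delta> * (d + 1) = \<eta>" using \<eta>(1) \<open>d \<ge> 0\<close> by (auto simp: \<delta>_def)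
  have "norm (midpoint u v - S (midpoint u v)) \<le> \<epsilon>"
    if S: "\<forall>u\<in>C. \<forall>v\<in>C. norm (S u - S v) \<le> (1 + \<delta>) * norm (u - v)"
      and uv: "u \<in> C" "v \<in> C" "norm (u - S u) \<le> \<delta>" "norm (v - S v) \<le> \<delta>" for S u v
  proof -
    define m where "m = midpoint u v"
    define r where "r = norm (u - v) / 2"
    have "m \<in> C"
      using convexD[OF C(1) uv(1,2), of "1/2" "1/2"] by (simp add: m_def midpoint_def scaleR_add_right)
    have r: "norm (m - u) = r" "norm (m - v) = r"
      using dist_midpoint[of u v] by (auto simp: m_def r_def dist_norm norm_minus_commute)
    have "r \<le> d" using d[OF uv(1,2)] \<open>d \<ge> 0\<close> by (simp add: r_def)
    have bound: "norm (S m - w) \<le> r + \<eta>" if "w \<in> C" "norm (w - S w) \<le> \<delta>" "norm (m - w) = r" for w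
    proof -
      have "norm (S m - w) \<le> norm (S m - S w) + norm (w - S w)"
        using norm_triangle_ineq4[of "S m - S w" "w - S w"] by (simp add: norm_minus_commute)
      also have "\<dots> \<le> (1 + \<delta>) * r + \<delta>"
        using S \<open>m \<in> C\<close> that by (intro add_mono) auto
      also have "\<dots> = r + \<delta> * (r + 1)" by (simp add: algebra_simps)
      also have "\<dots> \<le> r + \<delta> * (d + 1)" using \<delta>(1) \<open>r \<le> d\<close> by simp
      finally show ?thesis using \<delta>(2) by simp
    qed
    have "norm (S m - u) \<le> r + \<eta>" "norm (v - S m) \<le> r + \<eta>"
      using bound uv r by (auto simp: norm_minus_commute)
    moreover have "2 * (r - \<eta>) \<le> norm ((S m - u) + (v - S m))"
      using \<eta>(1) by (simp add: r_def norm_minus_commute)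
    ultimately have "norm ((S m - u) - (v - S m)) \<le> 2 * \<epsilon>"
      using \<eta>(2) \<open>r \<le> d\<close> by blast
    moreover have "(S m - u) - (v - S m) = 2 *\<^sub>R (S m - m)"
      by (simp add: m_def midpoint_def algebra_simps scaleR_2)
    ultimately have "norm (2 *\<^sub>R (S m - m)) \<le> 2 * \<epsilon>" by (simp only:)
    then show ?thesis by (simp add: m_def norm_minus_commute)
  qed
  with \<delta>(1) show ?thesis by blast
qed

text \<open>Chains the midpoint estimate: its tolerance \<open>\<delta>1\<close> for the last level
  is the target accuracy for the levels below. \<open>\<delta>\<close> precedes \<open>S\<close>
  since it must serve all late iterates \<open>T ^^ n\<close> at once.\<close>

lemma iterated_midpoints_approximate_fixed_point:
  fixes C :: "'a::real_normed_vector set"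
  assumes uc: "uniformly_convex_space TYPE('a)" and C: "convex C" "bounded C" and "\<epsilon> > 0"
  shows "\<exists>\<delta>>0. \<forall>S. (\<forall>u\<in>C. \<forall>v\<in>C. norm (S u - S v) \<le> (1 + \<delta>) * norm (u - v)) \<longrightarrow>
    (\<forall>z\<in>iterated_midpoints {z \<in> C. norm (z - S z) \<le> \<delta>} k. z \<in> C \<and> norm (z - S z) \<le> \<epsilon>)"
  using \<open>\<epsilon> > 0\<close>
proof (induction k arbitrary: \<epsilon>)
  case 0
  then show ?case by auto
next
  case (Suc k)
  obtain \<delta>1 where \<delta>1: "\<delta>1 > 0" "\<forall>S. (\<forall>u\<in>C. \<forall>v\<in>C. norm (S u - S v) \<le> (1 + \<delta>1) * norm (u - v)) \<longrightarrow>
    (\<forall>u\<in>C. \<forall>v\<in>C. norm (u - S u) \<le> \<delta>1 \<and> norm (v - S v) \<le> \<delta>1 \<longrightarrow>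
      norm (midpoint u v - S (midpoint u v)) \<le> \<epsilon>)"
    using midpoint_approximate_fixed_point[OF uc C Suc.prems] by blast
  obtain \<delta>2 where \<delta>2: "\<delta>2 > 0" "\<forall>S. (\<forall>u\<in>C. \<forall>v\<in>C. norm (S u - S v) \<le> (1 + \<delta>2) * norm (u - v)) \<longrightarrow>
    (\<forall>z\<in>iterated_midpoints {z \<in> C. norm (z - S z) \<le> \<delta>2} k. z \<in> C \<and> norm (z - S z) \<le> \<delta>1)"
    using Suc.IH[OF \<delta>1(1)] by blast
  define \<delta> where "\<delta> = min \<delta>1 \<delta>2"
  have "\<delta> > 0" using \<delta>1(1) \<delta>2(1) by (simp add: \<delta>_def)
  have "z \<in> C \<and> norm (z - S z) \<le> \<epsilon>"
    if S: "\<forall>u\<in>C. \<forall>v\<in>C. norm (S u - S v) \<le> (1 + \<delta>) * norm (u - v)"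
      and z: "z \<in> iterated_midpoints {z \<in> C. norm (z - S z) \<le> \<delta>} (Suc k)" for S z
  proof -
    have lip: "\<forall>u\<in>C. \<forall>v\<in>C. norm (S u - S v) \<le> (1 + \<delta>') * norm (u - v)" if "\<delta> \<le> \<delta>'" for \<delta>'
      using S that by (meson add_left_mono mult_right_mono norm_ge_zero order_trans)
    obtain a b where ab: "z = midpoint a b" "a \<in> iterated_midpoints {z \<in> C. norm (z - S z) \<le> \<delta>} k"
        "b \<in> iterated_midpoints {z \<in> C. norm (z - S z) \<le> \<delta>} k"
      using z by auto
    have "{z \<in> C. norm (z - S z) \<le> \<delta>} \<subseteq> {z \<in> C. norm (z - S z) \<le> \<delta>2}"
      by (auto simp: \<delta>_def)
    from iterated_midpoints_mono[OF this, of k] ab(2,3)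
    have "a \<in> C \<and> norm (a - S a) \<le> \<delta>1" "b \<in> C \<and> norm (b - S b) \<le> \<delta>1"
      using \<delta>2(2)[rule_format, of S] lip[of \<delta>2] by (auto simp: \<delta>_def)
    moreover from this have "midpoint a b \<in> C"
      using convexD[OF C(1), of a b "1/2" "1/2"] by (simp add: midpoint_def scaleR_add_right)
    ultimately show ?thesis
      using \<delta>1(2) lip[of \<delta>1] unfolding ab(1) by (auto simp: \<delta>_def)
  qed
  with \<open>\<delta> > 0\<close> show ?case by blast
qed

text \<open>A form of Bruck's convex approximation property. The number of midpoint iterations, hence
  \<open>\<delta>\<close>, can be fixed in advance, independently of the convex combination.\<close>

lemma convex_hull_approximate_fixed_points:
  fixes C :: "'a::real_normed_vector set"
  assumes uc: "uniformly_convex_space TYPE('a)" and C: "convex C" "bounded C" and "\<epsilon> > 0"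
  shows "\<exists>\<delta>>0. \<forall>S. (\<forall>u\<in>C. \<forall>v\<in>C. norm (S u - S v) \<le> (1 + \<delta>) * norm (u - v)) \<longrightarrow>
    (\<forall>z\<in>C \<inter> closure (convex hull {z \<in> C. norm (z - S z) \<le> \<delta>}). norm (z - S z) \<le> \<epsilon>)"
proof -
  obtain \<theta> where \<theta>: "0 < \<theta>" "\<theta> < 1"
    "\<And>r (a::'a) b. norm a \<le> r \<Longrightarrow> norm b \<le> r \<Longrightarrow>
       norm (a + b) \<le> 2 * (\<theta> * r) \<or> norm (a - b) \<le> 2 * (\<theta> * r)"
    using uniformly_convex_nonsquare[OF uc] by metis
  define d where "d = diameter C"
  have "d \<ge> 0" using C by (simp add: d_def diameter_ge_0)
  have d: "norm (u - v) \<le> d" if "u \<in> C" "v \<in> C" for u v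
    using diameter_bounded_bound[OF C(2) that] by (simp add: d_def dist_norm)
  have "(\<lambda>k. \<theta> ^ k * d / (1 - \<theta>)) \<longlonglongrightarrow> 0 * d / (1 - \<theta>)"
    using \<theta>(1,2) by (intro tendsto_intros LIMSEQ_power_zero) auto
  then have "\<forall>\<^sub>F k in sequentially. \<theta> ^ k * d / (1 - \<theta>) < \<epsilon> / 8"
    using \<open>\<epsilon> > 0\<close> by (intro order_tendstoD(2)) auto
  \<comment> \<open>Error budget: passing to level \<open>k\<close> and replacing \<open>z\<close>
    by \<open>a\<close> cost \<open>\<epsilon> / 8\<close> each, \<open>b - S b\<close> costs
    \<open>\<epsilon> / 4\<close>, and \<open>S b - S z\<close> takes the remaining
    \<open>\<epsilon> / 2\<close>.\<close>
  then obtain k where k: "\<theta> ^ k * d / (1 - \<theta>) < \<epsilon> / 8"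
    by (auto simp: eventually_sequentially)
  obtain \<delta>1 where \<delta>1: "\<delta>1 > 0" "\<forall>S. (\<forall>u\<in>C. \<forall>v\<in>C. norm (S u - S v) \<le> (1 + \<delta>1) * norm (u - v)) \<longrightarrow>
    (\<forall>z\<in>iterated_midpoints {z \<in> C. norm (z - S z) \<le> \<delta>1} k. z \<in> C \<and> norm (z - S z) \<le> \<epsilon> / 4)"
    using iterated_midpoints_approximate_fixed_point[OF uc C, of "\<epsilon> / 4" k] \<open>\<epsilon> > 0\<close> by auto
  \<comment> \<open>The cap 1 makes \<open>S\<close> Lipschitz with constant at most 2 on
    \<open>C\<close>.\<close>
  define \<delta> where "\<delta> = min \<delta>1 1"
  have \<delta>: "\<delta> > 0" "\<delta> \<le> \<delta>1" "\<delta> \<le> 1" using \<delta>1(1) by (auto simp: \<delta>_def)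
  have "norm (z - S z) \<le> \<epsilon>"
    if S: "\<forall>u\<in>C. \<forall>v\<in>C. norm (S u - S v) \<le> (1 + \<delta>) * norm (u - v)"
      and z: "z \<in> C" "z \<in> closure (convex hull {z \<in> C. norm (z - S z) \<le> \<delta>})" for S z
  proof -
    define M where "M = {z \<in> C. norm (z - S z) \<le> \<delta>}"
    have "z \<in> closure (\<Union>k. iterated_midpoints M k)"
      using z(2) convex_hull_subset_closure_iterated_midpoints by (auto simp: M_def)
    then obtain a m where a: "a \<in> iterated_midpoints M m" "dist a z < \<epsilon> / 8"
      using \<open>\<epsilon> > 0\<close> unfolding closure_approachable by (metis UN_E divide_pos_pos zero_less_numeral)
    have "\<And>u v. u \<in> M \<Longrightarrow> v \<in> M \<Longrightarrow> norm (u - v) \<le> d" using d by (auto simp: M_def)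
    from iterated_midpoints_approx[OF \<theta> this \<open>d \<ge> 0\<close> a(1), of k]
    obtain b where b: "b \<in> iterated_midpoints M k" "norm (a - b) \<le> \<theta> ^ k * d / (1 - \<theta>)"
      by blast
    have "\<forall>u\<in>C. \<forall>v\<in>C. norm (S u - S v) \<le> (1 + \<delta>1) * norm (u - v)"
      using S \<delta>(2) by (meson add_left_mono mult_right_mono norm_ge_zero order_trans)
    moreover have "M \<subseteq> {z \<in> C. norm (z - S z) \<le> \<delta>1}" using \<delta>(2) by (auto simp: M_def)
    ultimately have "b \<in> C" and bS: "norm (b - S b) \<le> \<epsilon> / 4"
      using \<delta>1(2) b(1) iterated_midpoints_mono[of M _ k] by blast+
    have zb: "norm (z - b) \<le> \<epsilon> / 4"
      using norm_triangle_ineq[of "z - a" "a - b"] a(2) order.strict_trans1[OF b(2) k]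
      by (simp add: dist_norm norm_minus_commute)
    have "norm (S b - S z) \<le> (1 + \<delta>) * norm (b - z)" using S \<open>b \<in> C\<close> z(1) by blast
    also have "\<dots> \<le> 2 * (\<epsilon> / 4)"
      using zb \<delta> by (intro mult_mono) (auto simp: norm_minus_commute)
    finally have "norm (S b - S z) \<le> \<epsilon> / 2" by simp
    moreover have "z - S z = (z - b) + ((b - S b) + (S b - S z))" by simp
    ultimately show ?thesis
      using norm_triangle_ineq[of "z - b" "(b - S b) + (S b - S z)"]
        norm_triangle_ineq[of "b - S b" "S b - S z"] zb bS by simp
  qed
  with \<delta>(1) show ?thesis by blast
qed

section \<open>Fixed points of asymptotically nonexpansive mappings\<close>

text \<open>The case \<open>n = 1\<close> makes \<open>T\<close> Lipschitz with constant
  \<open>k 1\<close>, so the shifted sequence of iterates tends to \<open>T z\<close> as well as to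
  \<open>z\<close>.\<close>

lemma asymptotically_nonexpansive_fixed_point_if_iterates_converge:
  fixes C :: "'a::real_normed_vector set"
  assumes T: "asymptotically_nonexpansive_on C T" and "z \<in> C" and lim: "(\<lambda>n. (T ^^ n) z) \<longlonglongrightarrow> z"
  shows "T z = z"
proof -
  obtain k where TC: "T \<in> C \<rightarrow> C"
    and k: "\<forall>n\<ge>1. \<forall>x\<in>C. \<forall>y\<in>C. norm ((T ^^ n) x - (T ^^ n) y) \<le> k n * norm (x - y)"
    using T unfolding asymptotically_nonexpansive_on_def by blast
  have iter: "(T ^^ n) z \<in> C" for n using TC \<open>z \<in> C\<close> by (induction n) auto
  have "norm ((T ^^ Suc n) z - T z) \<le> k 1 * norm ((T ^^ n) z - z)" for n
    using k[rule_format, of 1 "(T ^^ n) z" z] iter \<open>z \<in> C\<close> by simp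
  moreover have "(\<lambda>n. k 1 * norm ((T ^^ n) z - z)) \<longlonglongrightarrow> 0"
    using tendsto_mult_right_zero[OF tendsto_norm_zero[OF LIM_zero[OF lim]]] .
  ultimately have "(\<lambda>n. (T ^^ Suc n) z - T z) \<longlonglongrightarrow> 0"
    by (rule Lim_null_comparison[OF eventuallyI])
  then have "(\<lambda>n. (T ^^ Suc n) z) \<longlonglongrightarrow> T z" by (rule LIM_zero_cancel)
  with LIMSEQ_Suc[OF lim] show ?thesis using LIMSEQ_unique by blast
qed

text \<open>Goebel and Kirk: the asymptotic centre of an orbit is a fixed point.\<close>

lemma asymptotically_nonexpansive_has_fixed_point:
  fixes C :: "'a::banach set"
  assumes uc: "uniformly_convex_space TYPE('a)"
    and C: "C \<noteq> {}" "bounded C" "closed C" "convex C"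
    and T: "asymptotically_nonexpansive_on C T"
  shows "fixed_points_on C T \<noteq> {}"
proof -
  obtain k where TC: "T \<in> C \<rightarrow> C" and "k \<longlonglongrightarrow> 1"
    and k: "\<forall>n\<ge>1. \<forall>x\<in>C. \<forall>y\<in>C. norm ((T ^^ n) x - (T ^^ n) y) \<le> k n * norm (x - y)"
    and k1: "\<forall>n\<ge>1. 1 \<le> k n"
    using T unfolding asymptotically_nonexpansive_on_def by blast
  have iter: "(T ^^ n) z \<in> C" if "z \<in> C" for n z using TC that by (induction n) auto
  obtain y where "y \<in> C" using C(1) by blast
  define s where "s n = (T ^^ n) y" for n
  have sC: "s n \<in> C" for n using iter[OF \<open>y \<in> C\<close>] by (simp add: s_def)
  \<comment> \<open>\<open>A \<rho>\<close> gathers the points of \<open>C\<close> that are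
    eventually within \<open>\<rho>\<close> of the orbit; the infimum defined next is the asymptotic
    radius.\<close>
  define A where "A \<rho> = {z \<in> C. \<forall>\<^sub>F n in sequentially. norm (s n - z) \<le> \<rho>}" for \<rho>
  define \<rho> where "\<rho> = Inf {\<rho>. A \<rho> \<noteq> {}}"
  have A_nonneg: "\<rho> \<ge> 0" if ne: "A \<rho> \<noteq> {}" for \<rho>
  proof -
    obtain z where "\<forall>\<^sub>F n in sequentially. norm (s n - z) \<le> \<rho>" using ne by (auto simp: A_def)
    then obtain n where "norm (s n - z) \<le> \<rho>" by (auto simp: eventually_sequentially)
    then show ?thesis using norm_ge_zero order_trans by blast
  qed
  have "y \<in> A (diameter C)"
    using diameter_bounded_bound[OF C(2) sC \<open>y \<in> C\<close>] \<open>y \<in> C\<close> by (simp add: A_def dist_norm)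
  then have ne: "{\<rho>. A \<rho> \<noteq> {}} \<noteq> {}" by blast
  have bdd: "bdd_below {\<rho>. A \<rho> \<noteq> {}}" using A_nonneg by (intro bdd_belowI) auto
  have "\<rho> \<ge> 0" unfolding \<rho>_def using A_nonneg ne by (intro cInf_greatest) auto
  have A_mono: "A \<sigma> \<subseteq> A \<tau>" if "\<sigma> \<le> \<tau>" for \<sigma> \<tau>
    using that by (auto simp: A_def elim!: eventually_mono)
  have nonempty: "A (\<rho> + \<delta>) \<noteq> {}" if pos: "\<delta> > 0" for \<delta>
  proof -
    have "Inf {\<rho>. A \<rho> \<noteq> {}} < \<rho> + \<delta>" using pos by (simp add: \<rho>_def)
    then obtain \<sigma> where "A \<sigma> \<noteq> {}" "\<sigma> < \<rho> + \<delta>" using cInf_lessD[OF ne] by blast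
    then show ?thesis using A_mono[of \<sigma> "\<rho> + \<delta>"] by auto
  qed
  have small: "\<exists>\<delta>>0. \<forall>u\<in>A (\<rho> + \<delta>). \<forall>v\<in>A (\<rho> + \<delta>). dist u v \<le> \<epsilon>" if \<epsilon>: "\<epsilon> > 0" for \<epsilon>
  proof -
    obtain \<delta> where \<delta>: "\<delta> > 0"
      "\<forall>r (a::'a) b. r \<le> \<rho> \<and> norm a \<le> r + \<delta> \<and> norm b \<le> r + \<delta> \<and>
        2 * (r - \<delta>) \<le> norm (a + b) \<longrightarrow> norm (a - b) \<le> \<epsilon>"
      using uniformly_convex_modulus[OF uc \<epsilon>] by blast
    have "dist u v \<le> \<epsilon>" if uv: "u \<in> A (\<rho> + \<delta>)" "v \<in> A (\<rho> + \<delta>)" for u v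
    proof -
      have "midpoint u v \<in> C"
        using uv convexD[OF C(4), of u v "1/2" "1/2"] by (simp add: A_def midpoint_def scaleR_add_right)
      \<comment> \<open>Below the infimum the set is empty, so the orbit is infinitely often farther
        than \<open>\<rho> - \<delta>\<close> from the midpoint; some such index also satisfies both
        eventual bounds.\<close>
      moreover have "midpoint u v \<notin> A (\<rho> - \<delta>)"
        using cInf_lower[OF _ bdd, of "\<rho> - \<delta>"] \<delta>(1) by (auto simp: \<rho>_def[symmetric])
      ultimately have "\<exists>\<^sub>F n in sequentially. \<not> norm (s n - midpoint u v) \<le> \<rho> - \<delta>"
        by (simp add: A_def not_eventually)
      moreover have "\<forall>\<^sub>F n in sequentially. norm (s n - u) \<le> \<rho> + \<delta> \<and> norm (s n - v) \<le> \<rho> + \<delta>"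
        using uv by (auto simp: A_def eventually_conj)
      ultimately have "\<exists>\<^sub>F n in sequentially. (norm (s n - u) \<le> \<rho> + \<delta> \<and> norm (s n - v) \<le> \<rho> + \<delta>)
          \<and> \<not> norm (s n - midpoint u v) \<le> \<rho> - \<delta>"
        by (rule frequently_eventually_conj)
      then obtain n where n: "norm (s n - midpoint u v) \<ge> \<rho> - \<delta>"
          "norm (s n - u) \<le> \<rho> + \<delta>" "norm (s n - v) \<le> \<rho> + \<delta>"
        using frequently_ex by force
      have "(s n - u) + (s n - v) = 2 *\<^sub>R (s n - midpoint u v)"
        by (simp add: midpoint_def scaleR_diff_right scaleR_2)
      then have "2 * (\<rho> - \<delta>) \<le> norm ((s n - u) + (s n - v))" using n(1) by simp
      with n \<delta>(2)[rule_format, of \<rho> "s n - u" "s n - v"] show ?thesis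
        by (simp add: dist_norm norm_minus_commute)
    qed
    with \<delta>(1) show ?thesis by blast
  qed
  obtain z where z: "\<And>\<delta>. 0 < \<delta> \<Longrightarrow> z \<in> closure (A (\<rho> + \<delta>))"
    using shrinking_family_limit[of "\<lambda>\<delta>. A (\<rho> + \<delta>)", OF A_mono nonempty small] by auto
  have "A (\<rho> + 1) \<subseteq> C" by (auto simp: A_def)
  then have "z \<in> C" using z[of 1] closure_minimal[OF _ C(3)] by auto
  have zA: "z \<in> A (\<rho> + \<delta>)" if pos: "\<delta> > 0" for \<delta>
  proof -
    obtain w where w: "w \<in> A (\<rho> + \<delta> / 2)" "dist w z < \<delta> / 2"
      using z[of "\<delta> / 2"] pos unfolding closure_approachable by (meson half_gt_zero)
    then have "\<forall>\<^sub>F n in sequentially. norm (s n - w) \<le> \<rho> + \<delta> / 2" by (simp add: A_def)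
    then have "\<forall>\<^sub>F n in sequentially. norm (s n - z) \<le> \<rho> + \<delta>"
    proof eventually_elim
      case (elim n)
      then show ?case using w(2) norm_triangle_ineq[of "s n - w" "w - z"] by (simp add: dist_norm)
    qed
    with \<open>z \<in> C\<close> show ?thesis by (simp add: A_def)
  qed
  \<comment> \<open>\<open>T ^^ m\<close> shifts the orbit by \<open>m\<close> and \<open>k\<close>
    tends to 1, so \<open>(T ^^ m) z\<close> is for large \<open>m\<close> almost as good a centre
    as \<open>z\<close>. Near-optimal centres are close together, so the iterates converge to
    \<open>z\<close>.\<close>
  have TzA: "\<forall>\<^sub>F m in sequentially. (T ^^ m) z \<in> A (\<rho> + \<delta>)" if pos: "\<delta> > 0" for \<delta>
  proof -
    have "(\<lambda>m. k m * (\<rho> + \<delta> / 2)) \<longlonglongrightarrow> 1 * (\<rho> + \<delta> / 2)"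
      by (intro tendsto_intros \<open>k \<longlonglongrightarrow> 1\<close>)
    then have "\<forall>\<^sub>F m in sequentially. k m * (\<rho> + \<delta> / 2) < \<rho> + \<delta>"
      using pos by (intro order_tendstoD(2)) auto
    with eventually_ge_at_top[of 1] show ?thesis
    proof eventually_elim
      case (elim m)
      have "\<forall>\<^sub>F n in sequentially. norm (s n - z) \<le> \<rho> + \<delta> / 2"
        using zA[of "\<delta> / 2"] pos by (simp add: A_def)
      then have "\<forall>\<^sub>F n in sequentially. norm (s (n + m) - (T ^^ m) z) \<le> \<rho> + \<delta>"
      proof eventually_elim
        case (elim n)
        have "s (n + m) = (T ^^ m) (s n)"
          by (simp add: s_def add.commute[of n m] funpow_add)
        then have "norm (s (n + m) - (T ^^ m) z) \<le> k m * norm (s n - z)"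
          using k \<open>m \<ge> 1\<close> sC \<open>z \<in> C\<close> by simp
        also have "\<dots> \<le> k m * (\<rho> + \<delta> / 2)"
          using elim k1 \<open>m \<ge> 1\<close> by (intro mult_left_mono) (auto intro: order_trans[OF zero_le_one])
        finally show ?case using \<open>k m * (\<rho> + \<delta> / 2) < \<rho> + \<delta>\<close> by simp
      qed
      then have "\<forall>\<^sub>F n in sequentially. norm (s n - (T ^^ m) z) \<le> \<rho> + \<delta>"
        using eventually_sequentially_seg[of "\<lambda>n. norm (s n - (T ^^ m) z) \<le> \<rho> + \<delta>" m] by blast
      then show ?case
        using iter[OF \<open>z \<in> C\<close>] by (simp add: A_def)
    qed
  qed
  have "(\<lambda>m. (T ^^ m) z) \<longlonglongrightarrow> z"
  proof (rule tendstoI)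
    fix e :: real assume "e > 0"
    then obtain \<delta> where \<delta>: "\<delta> > 0" "\<forall>u\<in>A (\<rho> + \<delta>). \<forall>v\<in>A (\<rho> + \<delta>). dist u v \<le> e / 2"
      using small[of "e / 2"] by auto
    from TzA[OF \<delta>(1)] show "\<forall>\<^sub>F m in sequentially. dist ((T ^^ m) z) z < e"
    proof eventually_elim
      case (elim m)
      then have "dist ((T ^^ m) z) z \<le> e / 2" using \<delta>(2) zA[OF \<delta>(1)] by blast
      with \<open>e > 0\<close> show ?case by simp
    qed
  qed
  with \<open>z \<in> C\<close> have "z \<in> fixed_points_on C T"
    using asymptotically_nonexpansive_fixed_point_if_iterates_converge[OF T]
    by (simp add: fixed_points_on_def)
  then show ?thesis by blast
qed

section \<open>Convergence of the iteration\<close>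

theorem theorem3p3:
  fixes C :: "'a::banach set"
    and T :: "'a \<Rightarrow> 'a"
    and t :: "nat \<Rightarrow> real"
    and x :: 'a
    and xs :: "nat \<Rightarrow> 'a"
    and Cs Ds :: "nat \<Rightarrow> 'a set"
  assumes "uniformly_convex_space TYPE('a)" and "smooth_space TYPE('a)"
    and "C \<noteq> {}" and "bounded C" and "closed C" and "convex C"
    and "asymptotically_nonexpansive_on C T"
    and "\<And>n. n \<ge> 1 \<Longrightarrow> 0 < t n \<and> t n < 1" and "t \<longlonglongrightarrow> 0"
    and "x \<in> C"
    and "xs 1 = x" and "Cs 0 = C" and "Ds 0 = C"
    and "\<And>n. n \<ge> 1 \<Longrightarrow>
           Cs n = closure (convex hull
             {z \<in> Cs (n - 1). norm (z - (T ^^ n) z) \<le> t n * norm (xs n - (T ^^ n) (xs n))})"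
    and "\<And>n. n \<ge> 1 \<Longrightarrow>
           Ds n = {z \<in> Ds (n - 1). blinfun_apply (duality_map (x - xs n)) (xs n - z) \<ge> 0}"
    and "\<And>n. n \<ge> 1 \<Longrightarrow> xs (n + 1) = metric_projection (Cs n \<inter> Ds n) x"
  shows "is_metric_projection (fixed_points_on C T) x (metric_projection (fixed_points_on C T) x)
         \<and> xs \<longlonglongrightarrow> metric_projection (fixed_points_on C T) x"
proof -
  note uc = assms(1) and smooth = assms(2) and C = assms(3-6) and T = assms(7) and t = assms(8,9)
    and xs_1 = assms(11) and Cs_0 = assms(12) and Ds_0 = assms(13)
  define F where "F = fixed_points_on C T"
  have Cs_Suc: "Cs (Suc n) = closure (convex hull
      {z \<in> Cs n. norm (z - (T ^^ Suc n) z) \<le> t (Suc n) * norm (xs (Suc n) - (T ^^ Suc n) (xs (Suc n)))})"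
    and Ds_Suc: "Ds (Suc n) =
      {z \<in> Ds n. blinfun_apply (duality_map (x - xs (Suc n))) (xs (Suc n) - z) \<ge> 0}"
    and xs_Suc: "xs (Suc (Suc n)) = metric_projection (Cs (Suc n) \<inter> Ds (Suc n)) x" for n
    using assms(14)[of "Suc n"] assms(15)[of "Suc n"] assms(16)[of "Suc n"] by simp_all
  have Cs_closed: "closed (Cs n)" and Cs_convex: "convex (Cs n)" for n
    by (cases n; simp add: Cs_0 C Cs_Suc convex_closure del: funpow.simps)+
  \<comment> \<open>The set whose hull is taken lies in \<open>Cs n\<close>, already closed and
    convex.\<close>
  have Cs_le: "Cs (Suc n) \<subseteq> Cs n" for n
    unfolding Cs_Suc by (intro closure_minimal hull_minimal Cs_closed Cs_convex) auto
  then have Cs_dec: "decseq Cs" by (simp add: decseq_Suc_iff)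
  have Cs_C: "Cs n \<subseteq> C" for n using decseqD[OF Cs_dec, of 0 n] Cs_0 by simp
  have F_pow: "(T ^^ n) z = z" if "z \<in> F" for z n
    using that by (induction n) (auto simp: F_def fixed_points_on_def)
  \<comment> \<open>At a fixed point the left side of the defining inequality is 0.\<close>
  have F_Cs: "F \<subseteq> Cs n" for n
  proof (induction n)
    case 0
    then show ?case by (auto simp: F_def fixed_points_on_def Cs_0)
  next
    case (Suc n)
    have "F \<subseteq> {z \<in> Cs n. norm (z - (T ^^ Suc n) z)
        \<le> t (Suc n) * norm (xs (Suc n) - (T ^^ Suc n) (xs (Suc n)))}"
      using Suc F_pow[of _ "Suc n"] t(1)[of "Suc n"] by (auto simp del: funpow.simps)
    also have "\<dots> \<subseteq> Cs (Suc n)"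
      unfolding Cs_Suc by (rule order.trans[OF hull_subset closure_subset])
    finally show ?case .
  qed
  have "F \<noteq> {}"
    unfolding F_def using asymptotically_nonexpansive_has_fixed_point[OF uc C(1-4) T] .
  \<comment> \<open>The two claims need each other: the projection property on \<open>Cs n\<close>
    gives the variational inequality there, hence \<open>Cs (Suc n) \<subseteq> Ds (Suc n)\<close>,
    and then intersecting with \<open>Ds (Suc n)\<close> changes nothing. At 0, \<open>x\<close> is
    its own projection onto \<open>C\<close>.\<close>
  have "Cs n \<subseteq> Ds n \<and> is_metric_projection (Cs n) x (xs (Suc n))" for n
  proof (induction n)
    case 0
    then show ?case using xs_1 assms(10) by (simp add: Cs_0 Ds_0 is_metric_projection_def)
  next
    case (Suc n)
    have "0 \<le> blinfun_apply (duality_map (x - xs (Suc n))) (xs (Suc n) - z)" if "z \<in> Cs n" for z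
      using metric_projection_duality_nonneg[OF smooth Cs_convex _ that] Suc by blast
    then have sub: "Cs (Suc n) \<subseteq> Ds (Suc n)" using Suc Cs_le[of n] by (auto simp: Ds_Suc)
    then have "Cs (Suc n) \<inter> Ds (Suc n) = Cs (Suc n)" by blast
    moreover have "Cs (Suc n) \<noteq> {}" using F_Cs \<open>F \<noteq> {}\<close> by blast
    ultimately show ?case
      using sub is_metric_projection_metric_projection[OF uc Cs_closed Cs_convex] by (simp add: xs_Suc)
  qed
  then have proj: "is_metric_projection (Cs n) x (xs (Suc n))" for n by blast
  have "(\<Inter>n. Cs n) \<noteq> {}" using F_Cs \<open>F \<noteq> {}\<close> by blast
  from metric_projection_decseq_tendsto[OF uc Cs_closed Cs_convex Cs_dec this proj]
  obtain q where q: "(\<lambda>n. xs (Suc n)) \<longlonglongrightarrow> q" "is_metric_projection (\<Inter>n. Cs n) x q" by metis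
  then have qC: "q \<in> C" using Cs_C by (auto simp: is_metric_projection_def)
  have y_Cs: "xs (Suc n) \<in> Cs n" for n using proj by (simp add: is_metric_projection_def)
  obtain k where TC: "T \<in> C \<rightarrow> C" and k_lim: "k \<longlonglongrightarrow> 1"
    and k: "\<And>n u v. n \<ge> 1 \<Longrightarrow> u \<in> C \<Longrightarrow> v \<in> C \<Longrightarrow> norm ((T ^^ n) u - (T ^^ n) v) \<le> k n * norm (u - v)"
    using T unfolding asymptotically_nonexpansive_on_def by blast
  have iter: "(T ^^ n) z \<in> C" if "z \<in> C" for n z using TC that by (induction n) auto
  define d where "d = diameter C"
  have d: "norm (u - v) \<le> d" if "u \<in> C" "v \<in> C" for u v
    using diameter_bounded_bound[OF C(2) that] by (simp add: d_def dist_norm)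
  define y where "y n = xs (Suc n)" for n
  have yC: "y n \<in> C" for n using y_Cs Cs_C by (auto simp: y_def)
  \<comment> \<open>\<open>y n\<close> lies in \<open>Cs n\<close>, the closed hull of points moved
    by \<open>T ^^ n\<close> by at most \<open>t n * d\<close>. Once this is below
    \<open>\<delta>\<close> and \<open>k n < 1 + \<delta>\<close>, the convex approximation property
    applies with \<open>S = T ^^ n\<close>.\<close>
  have y_lim: "(\<lambda>n. y n - (T ^^ n) (y n)) \<longlonglongrightarrow> 0"
  proof (rule tendstoI)
    fix e :: real assume "e > 0"
    then obtain \<delta> where \<delta>: "\<delta> > 0"
      "\<forall>S. (\<forall>u\<in>C. \<forall>v\<in>C. norm (S u - S v) \<le> (1 + \<delta>) * norm (u - v)) \<longrightarrow>
        (\<forall>z\<in>C \<inter> closure (convex hull {z \<in> C. norm (z - S z) \<le> \<delta>}). norm (z - S z) \<le> e / 2)"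
      using convex_hull_approximate_fixed_points[OF uc C(4,2), of "e / 2"] by auto
    have "(\<lambda>n. t n * d) \<longlonglongrightarrow> 0" using tendsto_mult_left_zero[OF t(2)] .
    then have "\<forall>\<^sub>F n in sequentially. t n * d < \<delta>" using \<delta>(1) by (rule order_tendstoD)
    moreover have "\<forall>\<^sub>F n in sequentially. k n < 1 + \<delta>"
      using k_lim \<delta>(1) by (intro order_tendstoD(2)) auto
    ultimately show "\<forall>\<^sub>F n in sequentially. dist (y n - (T ^^ n) (y n)) 0 < e"
      using eventually_ge_at_top[of 1]
    proof eventually_elim
      case (elim n)
      have lip: "\<forall>u\<in>C. \<forall>v\<in>C. norm ((T ^^ n) u - (T ^^ n) v) \<le> (1 + \<delta>) * norm (u - v)"
        using k[OF \<open>1 \<le> n\<close>] elim(2) by (meson less_imp_le mult_right_mono norm_ge_zero order_trans)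
      obtain m where n: "n = Suc m" using \<open>1 \<le> n\<close> by (cases n) auto
      have "xs n \<in> C" using y_Cs[of m] Cs_C n by auto
      then have "t n * norm (xs n - (T ^^ n) (xs n)) \<le> t n * d"
        using t(1)[OF \<open>1 \<le> n\<close>] d iter by (intro mult_left_mono) auto
      then have "{z \<in> Cs m. norm (z - (T ^^ n) z) \<le> t n * norm (xs n - (T ^^ n) (xs n))}
          \<subseteq> {z \<in> C. norm (z - (T ^^ n) z) \<le> \<delta>}"
        using Cs_C elim(1) by fastforce
      then have "Cs n \<subseteq> closure (convex hull {z \<in> C. norm (z - (T ^^ n) z) \<le> \<delta>})"
        unfolding n Cs_Suc by (intro closure_mono hull_mono)
      then have "norm (y n - (T ^^ n) (y n)) \<le> e / 2"
        using \<delta>(2)[rule_format, OF lip[rule_format]] y_Cs[of n] yC[of n] by (auto simp: y_def)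
      with \<open>e > 0\<close> show ?case by simp
    qed
  qed
  have yq: "(\<lambda>n. y n - q) \<longlonglongrightarrow> 0" using q(1) by (simp add: y_def LIM_zero)
  \<comment> \<open>The convergent Lipschitz constants \<open>k n\<close> carry the estimate from
    the moving points \<open>y n\<close> over to \<open>q\<close>.\<close>
  have "(\<lambda>n. (T ^^ n) (y n) - (T ^^ n) q) \<longlonglongrightarrow> 0"
  proof (rule Lim_null_comparison)
    show "\<forall>\<^sub>F n in sequentially. norm ((T ^^ n) (y n) - (T ^^ n) q) \<le> k n * norm (y n - q)"
      using eventually_ge_at_top[of 1] by eventually_elim (use k yC qC in auto)
    show "(\<lambda>n. k n * norm (y n - q)) \<longlonglongrightarrow> 0"
      using tendsto_mult[OF k_lim tendsto_norm_zero[OF yq]] by simp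
  qed
  from tendsto_add[OF y_lim this] have "(\<lambda>n. y n - (T ^^ n) q) \<longlonglongrightarrow> 0" by simp
  from tendsto_diff[OF yq this] have "(\<lambda>n. (T ^^ n) q - q) \<longlonglongrightarrow> 0" by simp
  then have "T q = q"
    by (rule asymptotically_nonexpansive_fixed_point_if_iterates_converge[OF T qC LIM_zero_cancel])
  with qC have "q \<in> F" by (simp add: F_def fixed_points_on_def)
  moreover have F_sub: "F \<subseteq> (\<Inter>n. Cs n)" using F_Cs by blast
  ultimately have q_proj: "is_metric_projection F x q"
    using q(2) by (auto simp: is_metric_projection_def)
  \<comment> \<open>A minimiser over \<open>F\<close> is as close to \<open>x\<close> as
    \<open>q\<close>, so it also minimises over the closed convex intersection of the
    \<open>Cs n\<close>, where minimisers are unique.\<close>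
  moreover have "p = q" if p: "is_metric_projection F x p" for p
  proof -
    have "norm (p - x) \<le> norm (q - x)" "p \<in> F"
      using p \<open>q \<in> F\<close> by (auto simp: is_metric_projection_def)
    then have "is_metric_projection (\<Inter>n. Cs n) x p"
      using q(2) F_sub unfolding is_metric_projection_def by (meson order_trans subsetD)
    then show ?thesis
      using q(2) ex1_metric_projection[OF uc, of "\<Inter>n. Cs n" x] \<open>(\<Inter>n. Cs n) \<noteq> {}\<close>
        Cs_closed Cs_convex by (metis (no_types, lifting) closed_INT convex_INT)
  qed
  ultimately have "metric_projection F x = q"
    unfolding metric_projection_def by (rule the_equality)
  with q_proj q(1) show ?thesis by (simp add: F_def filterlim_sequentially_Suc)
qed

end
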